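(* Let $n\ge 3$ and let $\mathtt{d}=(d_1,\dots,d_n)$ be a sequence of non-negative integers with $\sum_{i=1}^n d_i=n-1$. Let $T_{\mathtt{d}}$ be a uniformly random rooted labelled tree with degree sequence $\mathtt{d}$. Then for all $s>0$, \[\mathbb{P}\big(\mathrm{Wd}(T_{\mathtt{d}})\,\mathrm{Ht}(T_{\mathtt{d}})>s\,n\log n\big)\le 230\,s^{-2/13}.\]
   Context: A rooted labelled tree with degree sequence $\mathtt{d}=(d_1,\dots,d_n)$ is an acyclic connected graph with vertex set $[n]=\{1,\dots,n\}$ together with a distinguished vertex (root) $r\in[n]$ such that the graph degree of $r$ is $d_r$ and the graph degree of every other $i\in[n]$ is $d_i+1$ (so each vertex $i$ has exactly $d_i$ children). For a rooted tree $t$, the height $\mathrm{Ht}(t)$ is the maximum graph distance of a vertex of $t$ to the root, and the width $\mathrm{Wd}(t)$ is the maximum over $h\ge 0$ of the number of vertices at distance exactly $h$ from the root. $\log$ is the natural logarithm. *)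

theory Defs
  imports "HOL-Probability.Probability" "Graph_Theory.Digraph_Component"
begin

text \<open>
  An undirected simple graph is a symmetric loop-free digraph without parallel arcs
  (\<^locale>\<open>pair_graph\<close>): every edge is represented by its two orientations, so the graph degree of
  a vertex is its \<^const>\<open>out_degree\<close>.
\<close>

text \<open>
  \<^const>\<open>pre_digraph.cycle\<close> also counts going back and forth along an edge (\<open>u \<rightarrow> v \<rightarrow> u\<close>); the
  cycles of the undirected graph are the ones with at least three arcs. For the same reason
  \<^const>\<open>Digraph_Component.forest\<close> cannot be used here.
\<close>

definition acyclic_graph :: "'a pair_pre_digraph \<Rightarrow> bool" where
  "acyclic_graph G \<longleftrightarrow> \<not> (\<exists>p. pre_digraph.cycle (with_proj G) p \<and> length p \<ge> 3)"

definition graph_dist :: "'a pair_pre_digraph \<Rightarrow> 'a \<Rightarrow> 'a \<Rightarrow> nat" where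
  "graph_dist G u v = (LEAST k. \<exists>p. pre_digraph.awalk (with_proj G) u p v \<and> length p = k)"

definition rooted_labelled_trees ::
    "nat \<Rightarrow> (nat \<Rightarrow> nat) \<Rightarrow> (nat pair_pre_digraph \<times> nat) set" where
  "rooted_labelled_trees n d = {(G, r).
     pair_graph G \<and> pverts G = {1..n} \<and>
     Digraph_Component.connected (with_proj G) \<and> acyclic_graph G \<and>
     r \<in> {1..n} \<and> out_degree (with_proj G) r = d r \<and>
     (\<forall>i \<in> {1..n} - {r}. out_degree (with_proj G) i = d i + 1)}"

fun tree_height :: "'a pair_pre_digraph \<times> 'a \<Rightarrow> nat" where
  "tree_height (G, r) = Max ((\<lambda>v. graph_dist G r v) ` pverts G)"

fun tree_width :: "'a pair_pre_digraph \<times> 'a \<Rightarrow> nat" where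
  "tree_width (G, r) = Max (range (\<lambda>h. card {v \<in> pverts G. graph_dist G r v = h}))"

text \<open>
  \<^const>\<open>pmf_of_set\<close> is only specified on finite nonempty sets. Finiteness always holds;
  nonemptiness holds when \<open>d\<close> sums to \<open>n - 1\<close> over \<open>{1..n}\<close> and \<open>n > 0\<close>.
\<close>

lemma finite_rooted_labelled_trees: "finite (rooted_labelled_trees n d)"
proof (rule finite_subset)
  let ?V = "{1..n}"
  show "rooted_labelled_trees n d \<subseteq>
      (\<lambda>A. \<lparr>pverts = ?V, parcs = A\<rparr>) ` Pow (?V \<times> ?V) \<times> ?V"
  proof safe
    fix G :: "nat pair_pre_digraph" and r
    assume "(G, r) \<in> rooted_labelled_trees n d"
    then have "pair_graph G" and V: "pverts G = ?V" and r: "r \<in> ?V"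
      by (auto simp: rooted_labelled_trees_def)
    then interpret pair_graph G by simp
    have "parcs G \<subseteq> ?V \<times> ?V"
      using in_arcsD1 in_arcsD2 unfolding V by fastforce
    moreover have "G = \<lparr>pverts = ?V, parcs = parcs G\<rparr>"
      using V by (cases G) simp
    ultimately show "G \<in> (\<lambda>A. \<lparr>pverts = ?V, parcs = A\<rparr>) ` Pow (?V \<times> ?V)"
      by blast
    show "r \<in> ?V" by (rule r)
  qed
qed simp

end

theory Submission
  imports Defs
begin

text \<open>
  A rooted labelled tree is encoded by its child-to-parent relation. Counting, in two ways, the
  possibilities to add one arc to a partial relation shows that a subforest with indegrees \<open>e\<^sub>i\<close> and \<open>m\<close>
  arcs is contained in exactly \<open>(n - 1 - m)! / (\<Prod>i. (d\<^sub>i - e\<^sub>i)!)\<close> trees. Let \<open>U = 1 + (\<Sum>i. d\<^sub>i (d\<^sub>i - 1))\<close>.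

  Height: summing over the possible ancestral paths, a vertex has depth at least \<open>k\<close> with probability at
  most \<open>e\<^sub>k(d) / (n - 1 choose k)\<close>, where \<open>e\<^sub>k\<close> is the elementary symmetric polynomial. Since this
  probability decreases in \<open>k\<close>, comparing generating functions at a suitable point bounds it by a
  quantity exponentially small in \<open>k \<surd>U / n\<close>, so the height is at most of order \<open>n log n / \<surd>U\<close>.

  Width: a cubic Lyapunov function for the breadth-first exploration shows that the width exceeds \<open>w\<close>
  with probability at most \<open>5 U / w\<^sup>2\<close>. Taking \<open>w = \<surd>s \<surd>U\<close>, the two bounds multiply to \<open>s n log n\<close>.
\<close>

section \<open>Counting trees containing a given subforest\<close>

text \<open>Neither factor of the product is controlled uniformly in \<open>d\<close>: a star is
  wide and flat, a path is high and thin. Both tails are therefore measured on the scale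
  \<open>sqrt (1 + U)\<close>, which cancels in the product (in the formal statements
  \<open>U\<close> is the sum without the summand 1). The logarithm is the price of a union bound
  over all vertices as possible deep ones. Probabilities appear only at the very end. The estimates
  concern cardinalities, mostly multiplied by the product of the \<open>fact (d i)\<close>; in this
  normalisation the total count is a plain factorial, and revealing a part of the tree becomes
  summation over sets. Comparing only the \<open>k\<close>-th coefficients with the full generating
  functions would lose a factor that is unbounded in general; using all \<open>j \<le> k\<close> at
  once loses only a factor 2. A union bound over the generations would likewise be too costly for
  the width; stopping at the first wide generation avoids it. The outcome is a tail
  \<open>53 / sqrt s\<close>, which decays faster than the claimed power of
  \<open>s\<close>.\<close>

definition parent_trees :: "'a set \<Rightarrow> ('a \<Rightarrow> nat) \<Rightarrow> ('a \<times> 'a) set set" where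
  "parent_trees V d = {E. E \<subseteq> V \<times> V \<and> single_valued E \<and> acyclic E \<and> (\<forall>i\<in>V. card (E\<inverse> `` {i}) = d i)}"

lemma finite_parent_trees: "finite V \<Longrightarrow> finite (parent_trees V d)"
  by (rule finite_subset[of _ "Pow (V \<times> V)"]) (auto simp: parent_trees_def)

lemma card_eq_sum_indegree:
  assumes "finite V" "finite A" "Q \<subseteq> A \<times> V"
  shows "card Q = (\<Sum>i\<in>V. card (Q\<inverse> `` {i}))"
proof -
  have Q: "Q\<inverse> = Sigma V (\<lambda>i. Q\<inverse> `` {i})" using assms(3) by auto
  have "card (Sigma V (\<lambda>i. Q\<inverse> `` {i})) = (\<Sum>i\<in>V. card (Q\<inverse> `` {i}))"
    by (rule card_SigmaI[OF assms(1)]) (use assms in \<open>auto intro: finite_subset[OF _ assms(2)]\<close>)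
  with Q have "card (Q\<inverse>) = (\<Sum>i\<in>V. card (Q\<inverse> `` {i}))" by simp
  then show ?thesis by simp
qed

lemma card_Domain_single_valued:
  assumes "single_valued Q"
  shows "card (Domain Q) = card Q"
proof -
  have "inj_on fst Q" using assms by (auto simp: inj_on_def single_valued_def)
  then show ?thesis by (simp add: Domain_fst card_image)
qed

text \<open>Climbing ends because \<open>Q\<close> is finite and acyclic, and paths of a
  single-valued relation cannot branch, so of two ends one reaches the other. Thus each component of
  a partial forest has exactly one parentless vertex, which makes the number of possible new
  children of a vertex independent of that vertex.\<close>

lemma ex1_root:
  assumes "finite Q" "single_valued Q" "acyclic Q"
  shows "\<exists>!u. u \<notin> Domain Q \<and> (v, u) \<in> Q\<^sup>*"
proof -
  have "wf (Q\<inverse>)" using assms by (simp add: finite_acyclic_wf_converse)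
  then have ex: "\<exists>u. u \<notin> Domain Q \<and> (v, u) \<in> Q\<^sup>*"
  proof (induction v rule: wf_induct_rule)
    case (less v)
    show ?case
    proof (cases "v \<in> Domain Q")
      case True
      then obtain w where "(v, w) \<in> Q" by auto
      with less[of w] show ?thesis by (auto intro: converse_rtrancl_into_rtrancl)
    qed auto
  qed
  moreover have "u = u'" if "u \<notin> Domain Q" "(v, u) \<in> Q\<^sup>*" "u' \<notin> Domain Q" "(v, u') \<in> Q\<^sup>*" for u u'
  proof -
    have "(u, u') \<in> Q\<^sup>* \<or> (u', u) \<in> Q\<^sup>*"
      using single_valued_confluent[OF assms(2) that(2,4)] .
    then show ?thesis using Not_Domain_rtrancl[OF that(1), of u'] Not_Domain_rtrancl[OF that(3), of u] by argo
  qed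
  ultimately show ?thesis by blast
qed

lemma card_parent_tree:
  assumes "finite V" "E \<in> parent_trees V d"
  shows "card E = (\<Sum>i\<in>V. d i)"
  using card_eq_sum_indegree[of V V E] assms by (auto simp: parent_trees_def)

text \<open>Induction on the number \<open>Suc m\<close> of missing arcs, by double counting pairs
  of a tree \<open>E\<close> above \<open>Q\<close> and an arc of \<open>E - Q\<close>. From the
  side of \<open>E\<close> there are \<open>Suc m\<close> arcs. From the side of an arc
  \<open>(u, v)\<close>, the induction hypothesis for \<open>insert (u, v) Q\<close> gives the
  weight \<open>(d v - e v) * fact m\<close>, where \<open>e v\<close> is the indegree of
  \<open>v\<close> in \<open>Q\<close>, and every \<open>v\<close> has \<open>Suc m\<close> choices
  of \<open>u\<close>. The product form avoids division.\<close>

lemma card_parent_trees_extending: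
  assumes "finite V" "Q \<subseteq> V \<times> V" "single_valued Q" "acyclic Q"
    "\<And>i. i \<in> V \<Longrightarrow> card (Q\<inverse> `` {i}) \<le> d i" "(\<Sum>i\<in>V. d i) + 1 = card V"
  shows "card {E \<in> parent_trees V d. Q \<subseteq> E} * (\<Prod>i\<in>V. fact (d i - card (Q\<inverse> `` {i})))
    = (fact (card V - 1 - card Q) :: nat)"
  using assms(2-5)
proof (induction "card V - 1 - card Q" arbitrary: Q)
  case 0
  note Q = 0(2-5)
  have finQ: "finite Q" using Q(1) assms(1) by (meson finite_SigmaI finite_subset)
  have cQ: "card Q = (\<Sum>i\<in>V. card (Q\<inverse> `` {i}))" using card_eq_sum_indegree assms(1) Q(1) by blast
  also have "\<dots> \<le> (\<Sum>i\<in>V. d i)" by (rule sum_mono) (use Q(4) in auto)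
  finally have c: "card Q = (\<Sum>i\<in>V. d i)" using 0(1) assms(6) by linarith
  have "card (Q\<inverse> `` {i}) = d i" if "i \<in> V" for i
  proof (rule ccontr)
    assume "card (Q\<inverse> `` {i}) \<noteq> d i"
    then have "card (Q\<inverse> `` {i}) < d i" using Q(4)[OF that] by simp
    then have "(\<Sum>i\<in>V. card (Q\<inverse> `` {i})) < (\<Sum>i\<in>V. d i)"
      using that Q(4) by (intro sum_strict_mono_ex1[OF assms(1)]) auto
    then show False using c cQ by simp
  qed
  then have "Q \<in> parent_trees V d" using Q by (auto simp: parent_trees_def)
  moreover have "E = Q" if "E \<in> parent_trees V d" "Q \<subseteq> E" for E
  proof -
    have "finite E" using that(1) assms(1) by (auto simp: parent_trees_def intro: finite_subset[of _ "V \<times> V"])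
    then show ?thesis using card_parent_tree[OF assms(1) that(1)] c that(2) by (metis card_subset_eq)
  qed
  ultimately have "{E \<in> parent_trees V d. Q \<subseteq> E} = {Q}" by auto
  then show ?case using 0(1) Q(4) \<open>\<And>i. i \<in> V \<Longrightarrow> card (Q\<inverse> `` {i}) = d i\<close> by (simp flip: 0(1))
next
  case (Suc m Q)
  note Q = Suc(3-6)
  have finQ: "finite Q" using Q(1) assms(1) by (meson finite_SigmaI finite_subset)
  let ?X = "{E \<in> parent_trees V d. Q \<subseteq> E}"
  let ?e = "\<lambda>i. card (Q\<inverse> `` {i})"
  let ?P = "\<Prod>i\<in>V. fact (d i - ?e i) :: nat"
  let ?Ok = "\<lambda>v. {u \<in> V - Domain Q. (v, u) \<notin> Q\<^sup>*}"
  let ?A = "{(u, v). v \<in> V \<and> u \<in> ?Ok v \<and> ?e v < d v}"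
  have finA: "finite ?A" by (rule finite_subset[of _ "V \<times> V"]) (use assms(1) in auto)
  have cQ: "card Q = (\<Sum>i\<in>V. ?e i)" using card_eq_sum_indegree assms(1) Q(1) by blast
  have finX: "finite ?X" using finite_parent_trees[OF assms(1)] by simp
  have fib: "finite (R\<inverse> `` {i})" if "R \<subseteq> V \<times> V" for R i
    using that assms(1) by (auto intro: finite_subset[OF _ assms(1)])
  have adm: "a \<in> ?A" if E: "E \<in> ?X" and a: "a \<in> E - Q" for E a
  proof -
    obtain u v where [simp]: "a = (u, v)" by force
    have EV: "E \<subseteq> V \<times> V" and sv: "single_valued E" and ac: "acyclic E" and QE: "Q \<subseteq> E"
      and deg: "\<And>i. i \<in> V \<Longrightarrow> card (E\<inverse> `` {i}) = d i"
      using E by (auto simp: parent_trees_def)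
    have uv: "(u, v) \<in> E" "(u, v) \<notin> Q" using a by auto
    have uvV: "u \<in> V" "v \<in> V" using uv EV by auto
    have "u \<notin> Domain Q" using uv QE sv by (auto simp: single_valued_def)
    moreover have "(v, u) \<notin> Q\<^sup>*"
    proof
      assume "(v, u) \<in> Q\<^sup>*"
      then have "(v, u) \<in> E\<^sup>*" using QE rtrancl_mono by blast
      then have "(u, u) \<in> E\<^sup>+" using uv(1) by (meson rtrancl_into_trancl2)
      then show False using ac by (auto simp: acyclic_def)
    qed
    moreover have "?e v < d v"
    proof -
      have "Q\<inverse> `` {v} \<subset> E\<inverse> `` {v}" using uv QE by auto
      then have "?e v < card (E\<inverse> `` {v})" by (rule psubset_card_mono[OF fib[OF EV]])
      then show ?thesis using deg[OF uvV(2)] by simp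
    qed
    ultimately show ?thesis using uvV by auto
  qed
  have one: "card {E \<in> parent_trees V d. insert a Q \<subseteq> E} * ?P = (d (snd a) - ?e (snd a)) * fact m"
    if "a \<in> ?A" for a
  proof -
    obtain u v where [simp]: "a = (u, v)" by force
    have uv: "u \<in> V" "v \<in> V" "u \<notin> Domain Q" "(v, u) \<notin> Q\<^sup>*" "?e v < d v" using that by auto
    define Q' where "Q' = insert (u, v) Q"
    have nin: "(u, v) \<notin> Q" using uv by auto
    have cQ': "card Q' = Suc (card Q)" using nin finQ by (simp add: Q'_def)
    have im: "Q'\<inverse> `` {i} = (if i = v then insert u (Q\<inverse> `` {v}) else Q\<inverse> `` {i})" for i
      by (auto simp: Q'_def)
    have e': "card (Q'\<inverse> `` {i}) = (if i = v then Suc (?e v) else ?e i)" for i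
      unfolding im using nin fib[OF Q(1), of v] by (simp add: card_insert_if)
    have mQ': "m = card V - 1 - card Q'" using Suc(2) cQ' by simp
    have "card {E \<in> parent_trees V d. Q' \<subseteq> E} * (\<Prod>i\<in>V. fact (d i - card (Q'\<inverse> `` {i})))
       = (fact (card V - 1 - card Q') :: nat)"
    proof (rule Suc(1))
      show "m = card V - 1 - card Q'" by (rule mQ')
      show "Q' \<subseteq> V \<times> V" using uv Q by (auto simp: Q'_def)
      show "single_valued Q'" using uv Q by (auto simp: single_valued_def Q'_def)
      show "acyclic Q'" using uv Q by (simp add: acyclic_insert Q'_def)
      show "card (Q'\<inverse> `` {i}) \<le> d i" if "i \<in> V" for i unfolding e' using uv Q(4)[OF that] by auto
    qed
    then have 1: "card {E \<in> parent_trees V d. Q' \<subseteq> E} * (\<Prod>i\<in>V. fact (d i - card (Q'\<inverse> `` {i}))) = fact m"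
      using mQ' by simp
    have 2: "?P = (d v - ?e v) * (\<Prod>i\<in>V. fact (d i - card (Q'\<inverse> `` {i})))"
    proof -
      have a: "fact (d v - ?e v) = (d v - ?e v) * fact (d v - Suc (?e v))"
        using uv(5) by (simp add: fact_reduce)
      have b: "(\<Prod>i\<in>V - {v}. fact (d i - card (Q'\<inverse> `` {i}))) = (\<Prod>i\<in>V - {v}. fact (d i - ?e i) :: nat)"
        by (rule prod.cong) (auto simp: e')
      have c: "?P = fact (d v - ?e v) * (\<Prod>i\<in>V - {v}. fact (d i - ?e i))"
        by (rule prod.remove[OF assms(1) uv(2)])
      have e: "(\<Prod>i\<in>V. fact (d i - card (Q'\<inverse> `` {i})) :: nat)
          = fact (d v - card (Q'\<inverse> `` {v})) * (\<Prod>i\<in>V - {v}. fact (d i - card (Q'\<inverse> `` {i})))"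
        by (rule prod.remove[OF assms(1) uv(2)])
      have f: "card (Q'\<inverse> `` {v}) = Suc (?e v)" by (simp add: e')
      show ?thesis unfolding c e a b f by (rule mult.assoc)
    qed
    show ?thesis
      unfolding \<open>a = (u, v)\<close> snd_conv Q'_def[symmetric] 2 by (subst mult.left_commute) (simp only: 1)
  qed
  \<comment> \<open>Of the \<open>card V - card Q = Suc (Suc m)\<close> parentless vertices only the
    root of the component of \<open>v\<close> is forbidden as a new child, since it would close a
    cycle.\<close>
  have cOk: "card (?Ok v) = Suc m" if "v \<in> V" for v
  proof -
    obtain r where r: "r \<notin> Domain Q" "(v, r) \<in> Q\<^sup>*" and r1: "\<And>u. u \<notin> Domain Q \<Longrightarrow> (v, u) \<in> Q\<^sup>* \<Longrightarrow> u = r"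
      using ex1_root[OF finQ Q(2,3), of v] by blast
    have rV: "r \<in> V" using r(2) Q(1) that by (induction) auto
    have "?Ok v = (V - Domain Q) - {r}" using r r1 by blast
    moreover have "card (V - Domain Q) = card V - card Q"
      using Q(1) finQ assms(1) by (subst card_Diff_subset) (auto simp: card_Domain_single_valued[OF Q(2)] finite_Domain)
    ultimately show ?thesis using r rV assms(1) Suc(2) by simp
  qed
  have "card ?X * Suc m = (\<Sum>E\<in>?X. card (E - Q))"
  proof -
    have "card (E - Q) = Suc m" if "E \<in> ?X" for E
      using that finQ card_parent_tree[OF assms(1), of E d] assms(6) Suc(2) by (simp add: card_Diff_subset)
    then show ?thesis by simp
  qed
  also have "\<dots> = (\<Sum>E\<in>?X. \<Sum>a | a \<in> ?A \<and> a \<in> E. 1)"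
  proof (rule sum.cong[OF refl])
    fix E assume "E \<in> ?X"
    then have "E - Q = {a \<in> ?A. a \<in> E}" using adm by (auto simp: Domain.simps)
    then show "card (E - Q) = (\<Sum>a | a \<in> ?A \<and> a \<in> E. 1)" by simp
  qed
  also have "\<dots> = (\<Sum>a\<in>?A. \<Sum>E | E \<in> ?X \<and> a \<in> E. 1)"
    by (rule sum.swap_restrict[OF finX finA])
  also have "\<dots> = (\<Sum>a\<in>?A. card {E \<in> parent_trees V d. insert a Q \<subseteq> E})"
  proof (rule sum.cong[OF refl])
    fix a
    have "{E. E \<in> ?X \<and> a \<in> E} = {E \<in> parent_trees V d. insert a Q \<subseteq> E}" by auto
    then show "(\<Sum>E | E \<in> ?X \<and> a \<in> E. 1) = card {E \<in> parent_trees V d. insert a Q \<subseteq> E}" by simp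
  qed
  finally have "card ?X * Suc m * ?P = (\<Sum>a\<in>?A. card {E \<in> parent_trees V d. insert a Q \<subseteq> E} * ?P)"
    by (simp add: sum_distrib_right)
  also have "\<dots> = (\<Sum>a\<in>?A. (d (snd a) - ?e (snd a)) * fact m)"
    by (rule sum.cong[OF refl]) (rule one)
  \<comment> \<open>Vertices \<open>v\<close> whose indegree has already reached \<open>d v\<close>
    are readmitted: their terms are 0, and the sum then runs over all of \<open>V\<close>.\<close>
  also have "\<dots> = (\<Sum>(v,u)\<in>Sigma V ?Ok. (d v - ?e v) * fact m)"
  proof -
    have "(\<Sum>(v,u)\<in>Sigma V ?Ok. (d v - ?e v) * fact m) = (\<Sum>(v,u)\<in>?A\<inverse>. (d v - ?e v) * fact m)"
      by (rule sum.mono_neutral_right) (use assms(1) Q(4) in auto)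
    also have "\<dots> = (\<Sum>a\<in>?A. (d (snd a) - ?e (snd a)) * fact m)"
      by (rule sum.reindex_bij_witness[of _ prod.swap prod.swap]) auto
    finally show ?thesis by simp
  qed
  also have "\<dots> = (\<Sum>v\<in>V. card (?Ok v) * ((d v - ?e v) * fact m))"
    by (subst sum.Sigma[symmetric]) (use assms(1) in auto)
  also have "\<dots> = Suc m * fact m * (\<Sum>v\<in>V. d v - ?e v)"
    using cOk by (simp add: sum_distrib_left algebra_simps)
  also have "(\<Sum>v\<in>V. d v - ?e v) = Suc m"
    using sum_subtractf_nat[of V ?e d] Q(4) cQ assms(6) Suc(2) by simp
  finally have "Suc m * (card ?X * ?P) = Suc m * (Suc m * fact m)" by (simp add: algebra_simps)
  then have "card ?X * ?P = fact (Suc m)" by (simp only: mult_cancel1) simp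
  then show ?case by (simp only: Suc(2))
qed

lemma card_parent_trees:
  assumes "finite V" "(\<Sum>i\<in>V. d i) + 1 = card V"
  shows "card (parent_trees V d) * (\<Prod>i\<in>V. fact (d i)) = (fact (card V - 1) :: nat)"
  using card_parent_trees_extending[of V "{}" d] assms by (simp add: acyclic_def single_valued_def)

section \<open>Height\<close>

primrec path_arcs :: "'a \<Rightarrow> 'a list \<Rightarrow> ('a \<times> 'a) set" where
  "path_arcs v [] = {}"
| "path_arcs v (u # q) = insert (v, u) (path_arcs u q)"

lemma Domain_path_arcs: "Domain (path_arcs v q) \<subseteq> set (v # q)"
  by (induction q arbitrary: v) auto

lemma Range_path_arcs: "Range (path_arcs v q) = set q"
  by (induction q arbitrary: v) auto

lemma rtrancl_path_arcs: "u \<in> set (v # q) \<Longrightarrow> (v, u) \<in> (path_arcs v q)\<^sup>*"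
proof (induction q arbitrary: v)
  case (Cons w q)
  show ?case
  proof (cases "u = v")
    case False
    then have "(w, u) \<in> (path_arcs w q)\<^sup>*" using Cons by auto
    then have "(w, u) \<in> (path_arcs v (w # q))\<^sup>*" by (rule rtrancl_mono[THEN subsetD, rotated]) auto
    then show ?thesis by (rule converse_rtrancl_into_rtrancl[rotated]) simp
  qed auto
qed auto

lemma single_valued_path_arcs: "distinct (v # q) \<Longrightarrow> single_valued (path_arcs v q)"
proof (induction q arbitrary: v)
  case (Cons w q)
  then have "v \<notin> Domain (path_arcs w q)" using Domain_path_arcs[of w q] by auto
  then show ?case using Cons by (auto simp: single_valued_def)
qed auto

lemma acyclic_path_arcs: "distinct (v # q) \<Longrightarrow> acyclic (path_arcs v q)"
proof (induction q arbitrary: v)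
  case (Cons w q)
  have "v \<notin> Range (path_arcs w q)" "v \<noteq> w" using Cons.prems by (auto simp: Range_path_arcs)
  then have "(w, v) \<notin> (path_arcs w q)\<^sup>*" by (auto elim: rtranclE)
  then show ?case using Cons by (simp add: acyclic_insert)
qed (simp add: acyclic_def)

text \<open>The starting vertex \<open>v\<close> has no child on the path, so only its ancestors
  \<open>q\<close> will contribute factors \<open>d i\<close>.\<close>

lemma indegree_path_arcs:
  "distinct (v # q) \<Longrightarrow> card ((path_arcs v q)\<inverse> `` {i}) = (if i \<in> set q then 1 else 0)"
proof (induction q arbitrary: v)
  case (Cons w q)
  have "(path_arcs w q)\<inverse> `` {w} = {}"
    using Cons.prems Range_path_arcs[of w q] by auto
  moreover have "(path_arcs v (w # q))\<inverse> `` {i}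
      = (if i = w then insert v ((path_arcs w q)\<inverse> `` {w}) else (path_arcs w q)\<inverse> `` {i})"
    by auto
  ultimately show ?case using Cons by auto
qed auto

lemma path_arcs_of_relpow:
  assumes "acyclic E" "(v, u) \<in> E ^^ k"
  shows "\<exists>q. length q = k \<and> distinct (v # q) \<and> path_arcs v q \<subseteq> E"
  using assms(2)
proof (induction k arbitrary: v)
  case 0
  show ?case by (intro exI[of _ "[]"]) auto
next
  case (Suc k)
  then obtain w where w: "(v, w) \<in> E" "(w, u) \<in> E ^^ k" by (meson relpow_Suc_D2)
  then obtain q where q: "length q = k" "distinct (w # q)" "path_arcs w q \<subseteq> E"
    using Suc.IH by blast
  have "v \<notin> set (w # q)"
  proof
    assume "v \<in> set (w # q)"
    then have "(w, v) \<in> E\<^sup>*" using rtrancl_path_arcs subsetD[OF rtrancl_mono[OF q(3)]] by metis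
    then have "(v, v) \<in> E\<^sup>+" using w(1) by (rule rtrancl_into_trancl2[rotated])
    then show False using assms(1) by (auto simp: acyclic_def)
  qed
  then show ?case using q w(1) by (intro exI[of _ "w # q"]) auto
qed

text \<open>The path gives one child to each vertex of \<open>q\<close>, which turns
  \<open>fact (d i)\<close> into \<open>fact (d i - 1)\<close> and leaves the factor
  \<open>d i\<close>. If some \<open>d i\<close> is 0 there, the counting lemma does not apply, but
  no tree contains the path and the product vanishes too.\<close>

lemma card_parent_trees_through_path:
  assumes "finite V" "(\<Sum>i\<in>V. d i) + 1 = card V" "distinct (v # q)" "set (v # q) \<subseteq> V"
  shows "card {E \<in> parent_trees V d. path_arcs v q \<subseteq> E} * (\<Prod>i\<in>V. fact (d i))
    = (fact (card V - 1 - length q) * (\<Prod>i\<in>set q. d i) :: nat)"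
proof -
  let ?Q = "path_arcs v q"
  let ?X = "{E \<in> parent_trees V d. ?Q \<subseteq> E}"
  have QV: "?Q \<subseteq> V \<times> V"
    using Domain_path_arcs[of v q] Range_path_arcs[of v q] assms(4) by (auto simp: subset_iff Domain_iff Range_iff)
  have deg: "card (?Q\<inverse> `` {i}) = (if i \<in> set q then 1 else 0)" for i
    by (rule indegree_path_arcs[OF assms(3)])
  have cQ: "card ?Q = length q"
  proof -
    have "card ?Q = (\<Sum>i\<in>V. if i \<in> set q then 1 else 0)"
      using card_eq_sum_indegree[OF assms(1,1) QV] deg by simp
    also have "\<dots> = card (set q)" using assms(1,4) by (simp flip: sum.inter_filter) (metis Int_absorb1 Int_def set_subset_Cons subset_trans)
    finally show ?thesis using assms(3) by (simp add: distinct_card)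
  qed
  show ?thesis
  proof (cases "\<forall>i\<in>set q. d i > 0")
    case True
    have "card ?X * (\<Prod>i\<in>V. fact (d i - card (?Q\<inverse> `` {i}))) = (fact (card V - 1 - card ?Q) :: nat)"
      by (rule card_parent_trees_extending[OF assms(1) QV single_valued_path_arcs[OF assms(3)]
          acyclic_path_arcs[OF assms(3)] _ assms(2)]) (use True in \<open>auto simp: deg\<close>)
    moreover have "(\<Prod>i\<in>V. fact (d i) :: nat)
        = (\<Prod>i\<in>V. fact (d i - card (?Q\<inverse> `` {i})) * (if i \<in> set q then d i else 1))"
      by (rule prod.cong[OF refl]) (use True in \<open>auto simp: deg fact_reduce\<close>)
    moreover have "(\<Prod>i\<in>V. if i \<in> set q then d i else 1) = (\<Prod>i\<in>set q. d i)"
      using assms(1,4) by (subst prod.inter_restrict[symmetric]) (auto simp: Int_absorb1)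
    ultimately show ?thesis by (simp add: prod.distrib cQ flip: mult.assoc)
  next
    case False
    then obtain i where i: "i \<in> set q" "d i = 0" by auto
    have "E \<notin> parent_trees V d" if "?Q \<subseteq> E" for E
    proof
      assume E: "E \<in> parent_trees V d"
      then have "finite (E\<inverse> `` {i})"
        using assms(1) by (auto simp: parent_trees_def intro: finite_subset[of _ V])
      moreover have "card (E\<inverse> `` {i}) = 0" using E i assms(4) by (auto simp: parent_trees_def)
      ultimately have "?Q\<inverse> `` {i} = {}" using that by auto
      then show False using i(1) Range_path_arcs[of v q] by auto
    qed
    then have "?X = {}" by auto
    moreover have "(\<Prod>i\<in>set q. d i) = 0" using i by auto
    ultimately show ?thesis by (simp only: card.empty mult_0 mult_0_right)
  qed
qed

text \<open>\<open>v \<in> Domain (E ^^ k)\<close> says that \<open>v\<close> has depth at least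
  \<open>k\<close>. The union bound runs over the list of the first \<open>k\<close> ancestors: a
  \<open>k\<close>-set \<open>S\<close> in any of its \<open>fact k\<close> orders, which all have
  the same weight.\<close>

lemma card_parent_trees_depth_ge:
  assumes "finite V" "(\<Sum>i\<in>V. d i) + 1 = card V" "v \<in> V"
  shows "card {E \<in> parent_trees V d. v \<in> Domain (E ^^ k)} * (\<Prod>i\<in>V. fact (d i))
    \<le> (fact (card V - 1 - k) * (fact k * (\<Sum>S | S \<subseteq> V \<and> card S = k. \<Prod>i\<in>S. d i)) :: nat)"
proof -
  let ?SS = "{S. S \<subseteq> V \<and> card S = k}"
  let ?L = "Sigma ?SS permutations_of_set"
  let ?L' = "{(S, q) \<in> ?L. v \<notin> S}"
  let ?X = "\<lambda>q. {E \<in> parent_trees V d. path_arcs v q \<subseteq> E}"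
  have fS: "finite ?SS" using assms(1) by auto
  have fL: "finite ?L" by (rule finite_SigmaI[OF fS]) auto
  then have fL': "finite ?L'" by (rule rev_finite_subset) auto
  have sub: "{E \<in> parent_trees V d. v \<in> Domain (E ^^ k)} \<subseteq> (\<Union>(S,q)\<in>?L'. ?X q)"
  proof
    fix E assume E: "E \<in> {E \<in> parent_trees V d. v \<in> Domain (E ^^ k)}"
    then have "acyclic E" and EV: "E \<subseteq> V \<times> V" by (auto simp: parent_trees_def)
    moreover obtain u where "(v, u) \<in> E ^^ k" using E by auto
    ultimately obtain q where q: "length q = k" "distinct (v # q)" "path_arcs v q \<subseteq> E"
      using path_arcs_of_relpow[of E v _ k] by metis
    have "set q \<subseteq> V" using Range_path_arcs[of v q] q(3) EV by auto
    then have "(set q, q) \<in> ?L'" using q by (auto simp: permutations_of_set_def distinct_card)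
    then show "E \<in> (\<Union>(S,q)\<in>?L'. ?X q)" using E q(3) by (intro UN_I[of "(set q, q)"]) auto
  qed
  have fT: "finite (parent_trees V d)" by (rule finite_parent_trees[OF assms(1)])
  have "card {E \<in> parent_trees V d. v \<in> Domain (E ^^ k)} \<le> card (\<Union>(S,q)\<in>?L'. ?X q)"
    by (rule card_mono[OF _ sub]) (use fL' fT in auto)
  also have "\<dots> \<le> (\<Sum>(S,q)\<in>?L'. card (?X q))"
    using card_UN_le[OF fL', of "\<lambda>(S,q). ?X q"] by (simp add: case_prod_unfold)
  finally have "card {E \<in> parent_trees V d. v \<in> Domain (E ^^ k)} * (\<Prod>i\<in>V. fact (d i))
      \<le> (\<Sum>(S,q)\<in>?L'. card (?X q)) * (\<Prod>i\<in>V. fact (d i))" by (rule mult_right_mono) simp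
  also have "\<dots> = (\<Sum>(S,q)\<in>?L'. card (?X q) * (\<Prod>i\<in>V. fact (d i)))"
    by (simp add: sum_distrib_right case_prod_unfold)
  also have "\<dots> = (\<Sum>(S,q)\<in>?L'. fact (card V - 1 - k) * (\<Prod>i\<in>S. d i))"
  proof (rule sum.cong[OF refl], clarify)
    fix S q assume h: "S \<subseteq> V" "k = card S" "q \<in> permutations_of_set S" "v \<notin> S"
    then have "set q = S" "distinct q" by (auto simp: permutations_of_set_def)
    with h have "length q = k" using distinct_card by fastforce
    then show "card (?X q) * (\<Prod>i\<in>V. fact (d i)) = fact (card V - 1 - card S) * (\<Prod>i\<in>S. d i)"
      using card_parent_trees_through_path[OF assms(1,2), of v q] assms(3) h \<open>set q = S\<close> \<open>distinct q\<close> by auto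
  qed
  \<comment> \<open>Admitting sets with \<open>v \<in> S\<close> as well only adds nonnegative terms
    and yields the full elementary symmetric polynomial, independent of \<open>v\<close>.\<close>
  also have "\<dots> \<le> (\<Sum>(S,q)\<in>?L. fact (card V - 1 - k) * (\<Prod>i\<in>S. d i))"
    by (rule sum_mono2[OF fL]) auto
  also have "\<dots> = (\<Sum>S\<in>?SS. \<Sum>q\<in>permutations_of_set S. fact (card V - 1 - k) * (\<Prod>i\<in>S. d i))"
    by (rule sum.Sigma[symmetric]) (use fS in auto)
  also have "\<dots> = (\<Sum>S\<in>?SS. fact k * (fact (card V - 1 - k) * (\<Prod>i\<in>S. d i)))"
    by (rule sum.cong[OF refl]) (use assms(1) in \<open>auto simp: finite_subset\<close>)
  also have "\<dots> = fact (card V - 1 - k) * (fact k * (\<Sum>S\<in>?SS. \<Prod>i\<in>S. d i))"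
    by (simp add: sum_distrib_left algebra_simps)
  finally show ?thesis .
qed

section \<open>Analytic estimates for the depth\<close>

lemma mult_ln_minus_ln_ge:
  fixes x :: real and k :: nat
  assumes "0 \<le> x" "x \<le> 1"
  shows "real (k * (k - 1)) * x\<^sup>2 / (4 * (1 + real k * x)) \<le> real k * ln (1 + x) - ln (1 + real k * x)"
proof -
  define c where "c = real (k * (k - 1))"
  have c: "c = real k * (real k - 1)" unfolding c_def by (cases k) (auto simp: algebra_simps)
  have c0: "c \<ge> 0" by (simp add: c_def)
  \<comment> \<open>The claim quantifies the gain in Bernoulli's inequality
    \<open>1 + k x \<le> (1 + x) ^ k\<close>. The two logarithms have derivative
    \<open>c t / ((1 + t) (1 + k t))\<close>, and \<open>1 + t \<le> 2\<close>; the quotient has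
    derivative at most \<open>2 c t / (4 (1 + k t))\<close>. The constant 4 makes these two bounds
    coincide.\<close>
  define f where "f = (\<lambda>t. real k * ln (1 + t) - ln (1 + real k * t) - c * t\<^sup>2 / (4 * (1 + real k * t)))"
  define f' where "f' = (\<lambda>t. real k / (1 + t) - real k / (1 + real k * t)
    - c * (2 * t * (1 + real k * t) - real k * t\<^sup>2) / (4 * (1 + real k * t)\<^sup>2))"
  have "f 0 \<le> f x"
  proof (rule DERIV_nonneg_imp_nondecreasing[OF assms(1)])
    fix t assume t: "0 \<le> t" "t \<le> x"
    then have t1: "t \<le> 1" using assms by simp
    have p: "1 + real k * t > 0" "1 + t > 0" using t by (auto intro: add_pos_nonneg)
    have "((\<lambda>t. real k * ln (1 + t)) has_real_derivative real k / (1 + t)) (at t)"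
      "((\<lambda>t. ln (1 + real k * t)) has_real_derivative real k / (1 + real k * t)) (at t)"
      using p by (auto intro!: derivative_eq_intros)
    moreover have "((\<lambda>t. c * t\<^sup>2 / (4 * (1 + real k * t))) has_real_derivative
        c * (2 * t * (1 + real k * t) - real k * t\<^sup>2) / (4 * (1 + real k * t)\<^sup>2)) (at t)"
    proof -
      have D: "((\<lambda>t. c * t\<^sup>2 / (4 * (1 + real k * t))) has_real_derivative
          ((c * (2 * t)) * (4 * (1 + real k * t)) - c * t\<^sup>2 * (4 * real k))
            / ((4 * (1 + real k * t)) * (4 * (1 + real k * t)))) (at t)"
        by (rule DERIV_divide) (use p in \<open>auto intro!: derivative_eq_intros\<close>)
      have eq: "((c * (2 * t)) * (4 * y) - c * t\<^sup>2 * (4 * real k)) / ((4 * y) * (4 * y))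
          = c * (2 * t * y - real k * t\<^sup>2) / (4 * y\<^sup>2)" if "y > 0" for y
        using that by (simp add: divide_simps power2_eq_square) (simp add: algebra_simps)
      show ?thesis using D unfolding eq[OF p(1)] .
    qed
    ultimately have "(f has_real_derivative f' t) (at t)"
      unfolding f_def f'_def by (intro DERIV_diff)
    moreover have "0 \<le> f' t"
    proof -
      have "real k / (1 + t) - real k / (1 + real k * t) = c * t / ((1 + t) * (1 + real k * t))"
        using p by (simp add: c divide_simps) (simp add: algebra_simps)
      moreover have "c * t / (2 * (1 + real k * t)) \<le> c * t / ((1 + t) * (1 + real k * t))"
        using p t t1 c0 by (intro divide_left_mono mult_right_mono) auto
      moreover have "c * (2 * t * (1 + real k * t) - real k * t\<^sup>2) / (4 * (1 + real k * t)\<^sup>2)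
          \<le> c * (2 * t * (1 + real k * t)) / (4 * (1 + real k * t)\<^sup>2)"
        using c0 by (intro divide_right_mono mult_left_mono) auto
      moreover have "c * (2 * t * (1 + real k * t)) / (4 * (1 + real k * t)\<^sup>2) = c * t / (2 * (1 + real k * t))"
        using p by (simp add: divide_simps power2_eq_square)
      ultimately show ?thesis unfolding f'_def by linarith
    qed
    ultimately show "\<exists>y. (f has_real_derivative y) (at t) \<and> 0 \<le> y" by blast
  qed
  then show ?thesis by (simp add: f_def c_def)
qed

text \<open>Markov's inequality for the binomial distribution with success probability \<open>x / (1 + x)\<close>.\<close>

lemma binomial_partial_sum_ge:
  fixes x :: real
  assumes "0 \<le> x" "2 * real N * x = real k" "k \<ge> 1"
  shows "(1 + x) ^ N / 2 \<le> (\<Sum>j\<le>min k N. real (N choose j) * x ^ j)"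
proof -
  let ?b = "\<lambda>j. real (N choose j) * x ^ j"
  have s0: "(\<Sum>j\<le>N. ?b j) = (1 + x) ^ N"
    using binomial_ring[of x 1 N] by (simp add: add.commute)
  have s1: "(\<Sum>j\<le>N. real j * ?b j) = real N * x * (1 + x) ^ (N - 1)"
  proof -
    have "(\<Sum>j\<le>N. real j * ?b j) = x * (\<Sum>j\<le>N. real j * real (N choose j) * x ^ (j - 1) * 1 ^ (N - j))"
      unfolding sum_distrib_left
    proof (rule sum.cong[OF refl])
      fix j show "real j * ?b j = x * (real j * real (N choose j) * x ^ (j - 1) * 1 ^ (N - j))"
        by (cases j) auto
    qed
    then show ?thesis using binomial_deriv1[where a = x and b = 1 and n = N] by (simp add: add.commute)
  qed
  have "real N * x * (1 + x) ^ (N - 1) \<le> real N * x * (1 + x) ^ N"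
    using assms(1) by (intro mult_left_mono power_increasing) auto
  also have "\<dots> = real k / 2 * (1 + x) ^ N" using assms(2) by simp
  finally have "real k * ((1 + x) ^ N / 2) \<le> (\<Sum>j\<le>N. (real k - real j) * ?b j)"
    using s0 s1 by (simp add: left_diff_distrib sum_subtractf flip: sum_distrib_left)
  also have "\<dots> \<le> (\<Sum>j\<le>N. if j \<le> k then real k * ?b j else 0)"
    using assms(1) by (intro sum_mono) (auto intro!: mult_right_mono mult_nonpos_nonneg)
  also have "\<dots> = real k * (\<Sum>j\<le>min k N. ?b j)"
    unfolding sum_distrib_left by (rule sum.mono_neutral_cong_right) auto
  finally show ?thesis using assms(3) by (simp add: mult_le_cancel_left)
qed

lemma prod_one_plus_expand:
  fixes d :: "'a \<Rightarrow> real"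
  assumes "finite V"
  shows "(\<Prod>i\<in>V. 1 + d i * x) = (\<Sum>j\<le>card V. (\<Sum>S | S \<subseteq> V \<and> card S = j. \<Prod>i\<in>S. d i) * x ^ j)"
proof -
  have "(\<Prod>i\<in>V. 1 + d i * x) = (\<Sum>S\<in>Pow V. (\<Prod>i\<in>S. d i * x) * (\<Prod>i\<in>V - S. 1))"
    using prod_add[OF assms, of "\<lambda>i. d i * x" "\<lambda>_. 1"] by (simp add: add.commute)
  also have "\<dots> = (\<Sum>S\<in>Pow V. (\<Prod>i\<in>S. d i) * x ^ card S)"
    by (simp add: prod.distrib)
  also have "\<dots> = (\<Sum>j\<le>card V. \<Sum>S | S \<in> Pow V \<and> card S = j. (\<Prod>i\<in>S. d i) * x ^ card S)"
    by (rule sum.group[symmetric]) (use assms in \<open>auto intro: card_mono\<close>)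
  also have "\<dots> = (\<Sum>j\<le>card V. (\<Sum>S | S \<subseteq> V \<and> card S = j. \<Prod>i\<in>S. d i) * x ^ j)"
    unfolding sum_distrib_right by (intro sum.cong) auto
  finally show ?thesis .
qed

lemma Domain_relpow_antimono:
  fixes E :: "('a \<times> 'a) set"
  assumes "v \<in> Domain (E ^^ k)" "j \<le> k" shows "v \<in> Domain (E ^^ j)"
proof -
  have "E ^^ k = E ^^ j O E ^^ (k - j)" using assms(2) by (simp flip: relpow_add)
  with assms(1) show ?thesis by auto
qed

text \<open>Let \<open>p j\<close> count the trees in which \<open>v\<close> has depth at least
  \<open>j\<close>. The inequalities \<open>p j * (N choose j) \<le> T * e j\<close> are multiplied
  by \<open>x ^ j\<close> and summed over \<open>j \<le> k\<close>, each \<open>p j\<close> on the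
  left being replaced by the smaller \<open>p k\<close>. The choice \<open>x = k / (2 N)\<close>
  keeps the binomial mean at most \<open>k / 2\<close>, so at least half of
  \<open>(1 + x) ^ N\<close> survives the truncation; this is the factor 2.\<close>

lemma card_depth_ge_le_prod:
  assumes "finite V" "(\<Sum>i\<in>V. d i) + 1 = card V" "v \<in> V" "N = card V - 1" "1 \<le> k" "k \<le> N"
    and x: "x = real k / (2 * real N)"
  shows "real (card {E \<in> parent_trees V d. v \<in> Domain (E ^^ k)}) * (1 + x) ^ N
    \<le> 2 * real (card (parent_trees V d)) * (\<Prod>i\<in>V. 1 + real (d i) * x)"
proof -
  define p where "p = (\<lambda>j. real (card {E \<in> parent_trees V d. v \<in> Domain (E ^^ j)}))"
  define e where "e = (\<lambda>j. \<Sum>S | S \<subseteq> V \<and> card S = j. \<Prod>i\<in>S. real (d i))"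
  define T where "T = real (card (parent_trees V d))"
  define F where "F = (\<Prod>i\<in>V. fact (d i) :: real)"
  have N0: "N > 0" using assms by simp
  have x0: "x \<ge> 0" using x by simp
  have F0: "F > 0" by (auto simp: F_def intro: prod_pos)
  have TF: "T * F = fact N"
    using arg_cong[OF card_parent_trees[OF assms(1,2)], of real] by (simp add: T_def F_def assms(4))
  have pj: "p j * real (N choose j) \<le> T * e j" if "j \<le> N" for j
  proof -
    have "p j * F \<le> fact (N - j) * (fact j * e j)"
      using card_parent_trees_depth_ge[OF assms(1-3), of j, THEN of_nat_mono[where 'a = real]]
      by (simp add: p_def F_def e_def assms(4))
    then have "(p j * F) * real (N choose j) \<le> fact (N - j) * (fact j * e j) * real (N choose j)"
      by (rule mult_right_mono) simp
    also have "\<dots> = (T * e j) * F"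
      using binomial_fact_lemma[OF that] TF by (metis (no_types, lifting) mult.assoc mult.commute of_nat_fact of_nat_mult)
    finally have "(p j * real (N choose j)) * F \<le> (T * e j) * F" by (simp add: algebra_simps)
    then show ?thesis using F0 by simp
  qed
  have anti: "p k \<le> p j" if "j \<le> k" for j
  proof -
    have "{E \<in> parent_trees V d. v \<in> Domain (E ^^ k)} \<subseteq> {E \<in> parent_trees V d. v \<in> Domain (E ^^ j)}"
      by (intro Collect_mono impI conjI; elim conjE) (assumption, rule Domain_relpow_antimono[OF _ that])
    then show ?thesis
      unfolding p_def using finite_parent_trees[OF assms(1)] by (intro of_nat_mono card_mono) auto
  qed
  have "p k * ((1 + x) ^ N / 2) \<le> p k * (\<Sum>j\<le>min k N. real (N choose j) * x ^ j)"
  proof (rule mult_left_mono)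
    have "2 * real N * x = real k" using N0 by (simp add: x)
    then show "(1 + x) ^ N / 2 \<le> (\<Sum>j\<le>min k N. real (N choose j) * x ^ j)"
      by (rule binomial_partial_sum_ge[OF x0 _ assms(5)])
  qed (simp add: p_def)
  also have "\<dots> \<le> (\<Sum>j\<le>min k N. (p j * real (N choose j)) * x ^ j)"
    unfolding sum_distrib_left using x0 anti
    by (intro sum_mono) (auto simp: mult.assoc[symmetric] intro!: mult_right_mono)
  also have "\<dots> \<le> (\<Sum>j\<le>min k N. T * e j * x ^ j)"
    using x0 pj by (intro sum_mono mult_right_mono) auto
  also have "\<dots> \<le> (\<Sum>j\<le>card V. T * e j * x ^ j)"
    using x0 assms(4) by (intro sum_mono2) (auto simp: T_def e_def intro!: mult_nonneg_nonneg sum_nonneg prod_nonneg)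
  also have "\<dots> = T * (\<Prod>i\<in>V. 1 + real (d i) * x)"
    unfolding prod_one_plus_expand[OF assms(1)] e_def
    by (simp only: sum_distrib_left[where A = "{..card V}"] mult.assoc)
  finally show ?thesis by (simp add: p_def T_def)
qed

lemma prod_one_plus_le_exp:
  fixes d :: "'a \<Rightarrow> nat" and x :: real
  assumes "finite V" "0 \<le> x" "x \<le> 1" "U = (\<Sum>i\<in>V. real (d i * (d i - 1)))"
  shows "(\<Prod>i\<in>V. 1 + real (d i) * x)
    \<le> (1 + x) ^ (\<Sum>i\<in>V. d i) * exp (- (U * x\<^sup>2 / (4 * (1 + x + sqrt U * x))))"
proof -
  let ?D = "4 * (1 + x + sqrt U * x)"
  have U0: "U \<ge> 0" using assms(4) by (simp add: sum_nonneg)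
  have le: "real (d i * (d i - 1)) * x\<^sup>2 / ?D \<le> real (d i) * ln (1 + x) - ln (1 + real (d i) * x)"
    if "i \<in> V" for i
  proof -
    \<comment> \<open>The factors need one common denominator for their gains to add up to a
      multiple of \<open>U\<close>. For \<open>d i > 0\<close> one has
      \<open>(d i - 1)\<^sup>2 \<le> d i * (d i - 1) \<le> U\<close>, so no degree exceeds
      \<open>1 + sqrt U\<close>.\<close>
    have "real (d i * (d i - 1)) \<le> U" unfolding assms(4) using assms(1) that by (intro member_le_sum) auto
    moreover have "d i = 0 \<or> (real (d i) - 1)\<^sup>2 \<le> real (d i * (d i - 1))"
      by (cases "d i") (auto simp: power2_eq_square algebra_simps)
    ultimately have "real (d i) = 0 \<or> real (d i) - 1 \<le> sqrt U" by (auto intro!: real_le_rsqrt)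
    then have "real (d i) - 1 \<le> sqrt U" using real_sqrt_ge_zero[OF U0] by linarith
    then have "(real (d i) - 1) * x \<le> sqrt U * x" using assms(2) by (rule mult_right_mono)
    then have "1 + real (d i) * x \<le> 1 + x + sqrt U * x"
      using left_diff_distrib[of "real (d i)" 1 x] by linarith
    moreover have "1 + real (d i) * x > 0" using assms(2) by (intro add_pos_nonneg) auto
    ultimately have "real (d i * (d i - 1)) * x\<^sup>2 / ?D \<le> real (d i * (d i - 1)) * x\<^sup>2 / (4 * (1 + real (d i) * x))"
      by (intro frac_le) auto
    also have "\<dots> \<le> real (d i) * ln (1 + x) - ln (1 + real (d i) * x)"
      by (rule mult_ln_minus_ln_ge[OF assms(2,3)])
    finally show ?thesis .
  qed
  have "1 + real (d i) * x \<le> (1 + x) ^ d i * exp (- (real (d i * (d i - 1)) * x\<^sup>2 / ?D))" if "i \<in> V" for i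
  proof -
    have "1 + real (d i) * x > 0" using assms(2) by (intro add_pos_nonneg) auto
    then have "1 + real (d i) * x = exp (ln (1 + real (d i) * x))" by simp
    also have "\<dots> \<le> exp (real (d i) * ln (1 + x) - real (d i * (d i - 1)) * x\<^sup>2 / ?D)"
      using le[OF that] by simp
    also have "\<dots> = exp (real (d i) * ln (1 + x)) * exp (- (real (d i * (d i - 1)) * x\<^sup>2 / ?D))"
      unfolding exp_add[symmetric] by simp
    also have "exp (real (d i) * ln (1 + x)) = (1 + x) ^ d i"
      using assms(2) by (simp add: exp_of_nat_mult)
    finally show ?thesis .
  qed
  then have "(\<Prod>i\<in>V. 1 + real (d i) * x)
      \<le> (\<Prod>i\<in>V. (1 + x) ^ d i * exp (- (real (d i * (d i - 1)) * x\<^sup>2 / ?D)))"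
    using assms(2) by (intro prod_mono) (auto intro: add_nonneg_nonneg)
  also have "\<dots> = (1 + x) ^ (\<Sum>i\<in>V. d i) * exp (\<Sum>i\<in>V. - (real (d i * (d i - 1)) * x\<^sup>2 / ?D))"
    using assms(1) by (simp only: prod.distrib power_sum exp_sum)
  also have "(\<Sum>i\<in>V. - (real (d i * (d i - 1)) * x\<^sup>2 / ?D)) = - (U * x\<^sup>2 / ?D)"
  proof -
    have "(\<Sum>i\<in>V. - (c i * y / z)) = - ((\<Sum>i\<in>V. c i) * y / z)" for c :: "'a \<Rightarrow> real" and y z
      by (simp add: sum_negf sum_distrib_right sum_divide_distrib)
    from this[of "\<lambda>i. real (d i * (d i - 1))"] show ?thesis unfolding assms(4) .
  qed
  finally show ?thesis .
qed

lemma relpow_parent_tree_less_card: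
  assumes "finite V" "E \<in> parent_trees V d" "(v, u) \<in> E ^^ k" "v \<in> V"
  shows "k < card V"
proof -
  have E: "acyclic E" "E \<subseteq> V \<times> V" using assms(2) by (auto simp: parent_trees_def)
  obtain q where q: "length q = k" "distinct (v # q)" "path_arcs v q \<subseteq> E"
    using path_arcs_of_relpow[OF E(1) assms(3)] by metis
  have "set q \<subseteq> V" using Range_path_arcs[of v q] q(3) E(2) by auto
  then have "card (set (v # q)) \<le> card V" using assms(1,4) by (intro card_mono) auto
  then show ?thesis using q(1) distinct_card[OF q(2)] by simp
qed

text \<open>The factor \<open>card V\<close> is the union bound over the deep vertex. The degrees
  sum to \<open>card V - 1\<close>, so the powers of \<open>1 + x\<close> on both sides cancel and
  only the exponential gain remains. Beyond \<open>k = card V - 1\<close> no vertex has that many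
  ancestors.\<close>

lemma card_parent_trees_height_ge:
  assumes "finite V" "(\<Sum>i\<in>V. d i) + 1 = card V" "k \<ge> 1"
    and x: "x = real k / (2 * real (card V - 1))"
    and U: "U = (\<Sum>i\<in>V. real (d i * (d i - 1)))"
  shows "real (card {E \<in> parent_trees V d. \<exists>v\<in>V. v \<in> Domain (E ^^ k)})
    \<le> 2 * real (card V) * exp (- (U * x\<^sup>2 / (4 * (1 + x + sqrt U * x)))) * real (card (parent_trees V d))"
    (is "real (card ?B) \<le> _ * ?ex * ?T")
proof (cases "k \<le> card V - 1")
  case True
  have x01: "0 \<le> x" "x \<le> 1" using True assms(3) by (auto simp: x divide_simps)
  have one: "real (card {E \<in> parent_trees V d. v \<in> Domain (E ^^ k)}) \<le> 2 * ?ex * ?T" if "v \<in> V" for v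
  proof -
    have "real (card {E \<in> parent_trees V d. v \<in> Domain (E ^^ k)}) * (1 + x) ^ (card V - 1)
        \<le> 2 * ?T * (\<Prod>i\<in>V. 1 + real (d i) * x)"
      using card_depth_ge_le_prod[OF assms(1,2) that refl assms(3) True x] .
    also have "\<dots> \<le> 2 * ?T * ((1 + x) ^ (\<Sum>i\<in>V. d i) * ?ex)"
      by (intro mult_left_mono prod_one_plus_le_exp[OF assms(1) x01 U]) simp
    also have "(\<Sum>i\<in>V. d i) = card V - 1" using assms(2) by simp
    finally have "real (card {E \<in> parent_trees V d. v \<in> Domain (E ^^ k)}) * (1 + x) ^ (card V - 1)
        \<le> (2 * ?ex * ?T) * (1 + x) ^ (card V - 1)" by (simp only: mult_ac)
    then show ?thesis using x01 by (simp add: mult_le_cancel_right)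
  qed
  have "?B = (\<Union>v\<in>V. {E \<in> parent_trees V d. v \<in> Domain (E ^^ k)})"
    unfolding set_eq_iff UN_iff mem_Collect_eq by metis
  then have "card ?B \<le> (\<Sum>v\<in>V. card {E \<in> parent_trees V d. v \<in> Domain (E ^^ k)})"
    by (simp only: card_UN_le[OF assms(1)])
  then have "real (card ?B) \<le> (\<Sum>v\<in>V. real (card {E \<in> parent_trees V d. v \<in> Domain (E ^^ k)}))"
    unfolding of_nat_sum[symmetric] by (rule of_nat_mono)
  also have "\<dots> \<le> (\<Sum>v\<in>V. 2 * ?ex * ?T)" by (rule sum_mono) (rule one)
  finally show ?thesis by (simp add: mult_ac)
next
  case False
  have "?B = {}" using relpow_parent_tree_less_card[OF assms(1)] False by fastforce
  then have "card ?B = 0" by (simp only: card.empty)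
  then show ?thesis by simp
qed

section \<open>Width\<close>

text \<open>Unlike in \<open>parent_trees\<close> the roots are given, because the exploration
  repeatedly replaces them by their children; \<open>Domain E = B\<close> forces every other vertex
  to hang below some root.\<close>

definition parent_forests :: "'a set \<Rightarrow> 'a set \<Rightarrow> ('a \<Rightarrow> nat) \<Rightarrow> ('a \<times> 'a) set set" where
  "parent_forests R B d = {E. E \<subseteq> B \<times> (R \<union> B) \<and> Domain E = B \<and> single_valued E \<and> acyclic E \<and>
     (\<forall>i\<in>R \<union> B. card (E\<inverse> `` {i}) = d i)}"

lemma finite_parent_forests: "finite R \<Longrightarrow> finite B \<Longrightarrow> finite (parent_forests R B d)"
  by (rule finite_subset[of _ "Pow (B \<times> (R \<union> B))"]) (auto simp: parent_forests_def)

definition assignments :: "'a set \<Rightarrow> 'a set \<Rightarrow> ('a \<Rightarrow> nat) \<Rightarrow> ('a \<times> 'a) set set" where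
  "assignments C R d = {F. F \<subseteq> C \<times> R \<and> Domain F = C \<and> single_valued F \<and> (\<forall>i\<in>R. card (F\<inverse> `` {i}) = d i)}"

lemma finite_assignments: "finite C \<Longrightarrow> finite R \<Longrightarrow> finite (assignments C R d)"
  by (rule finite_subset[of _ "Pow (C \<times> R)"]) (auto simp: assignments_def)

text \<open>The bound is the multinomial coefficient for maps from \<open>C\<close> to
  \<open>R\<close> with prescribed fibre sizes. The induction chooses the fibre over one
  \<open>r\<close> and recurses on the rest of \<open>C\<close>. An inequality is enough, since all
  width estimates are upper bounds.\<close>

lemma card_assignments_le:
  assumes "finite R" "finite C"
  shows "card (assignments C R d) * (\<Prod>i\<in>R. fact (d i)) \<le> (fact (card C) :: nat)"
  using assms
proof (induction R arbitrary: C rule: finite_induct)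
  case empty
  have "assignments C {} d \<subseteq> {{}}" by (auto simp: assignments_def)
  then have "card (assignments C {} d) \<le> card {{} :: ('a \<times> 'a) set}" by (intro card_mono) auto
  also have "\<dots> \<le> fact (card C)" by (simp add: Suc_le_eq)
  finally show ?case by simp
next
  case (insert r R)
  let ?SS = "{S. S \<subseteq> C \<and> card S = d r}"
  let ?g = "\<lambda>F. (F\<inverse> `` {r}, F \<inter> UNIV \<times> R)"
  have fSS: "finite ?SS" using insert.prems by auto
  have inj: "inj_on ?g (assignments C (insert r R) d)"
  proof (rule inj_onI)
    fix F F' assume F: "F \<in> assignments C (insert r R) d" "F' \<in> assignments C (insert r R) d"
      and eq: "?g F = ?g F'"
    have "F = (F\<inverse> `` {r}) \<times> {r} \<union> F \<inter> UNIV \<times> R" if "F \<in> assignments C (insert r R) d" for F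
      using that by (auto simp: assignments_def)
    with F eq show "F = F'" by (metis prod.inject)
  qed
  have im: "?g ` assignments C (insert r R) d \<subseteq> Sigma ?SS (\<lambda>S. assignments (C - S) R d)"
  proof (rule image_subsetI)
    fix F assume F: "F \<in> assignments C (insert r R) d"
    then have FD: "F \<subseteq> C \<times> insert r R" "Domain F = C" "single_valued F"
      "\<And>i. i \<in> insert r R \<Longrightarrow> card (F\<inverse> `` {i}) = d i" by (auto simp: assignments_def)
    have "(F \<inter> UNIV \<times> R)\<inverse> `` {i} = F\<inverse> `` {i}" if "i \<in> R" for i using that by auto
    moreover have "Domain (F \<inter> UNIV \<times> R) = C - F\<inverse> `` {r}"
    proof -
      have "u \<in> Domain (F \<inter> UNIV \<times> R) \<longleftrightarrow> u \<in> C \<and> (u, r) \<notin> F" for u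
      proof
        assume "u \<in> Domain (F \<inter> UNIV \<times> R)"
        then obtain i where "(u, i) \<in> F" "i \<in> R" by auto
        then show "u \<in> C \<and> (u, r) \<notin> F"
          using FD(1,3) insert.hyps(2) unfolding single_valued_def by blast
      next
        assume u: "u \<in> C \<and> (u, r) \<notin> F"
        then obtain i where "(u, i) \<in> F" using FD(2) by blast
        then show "u \<in> Domain (F \<inter> UNIV \<times> R)" using u FD(1) by blast
      qed
      then show ?thesis by auto
    qed
    moreover have "single_valued (F \<inter> UNIV \<times> R)" using FD(3) by (auto simp: single_valued_def)
    ultimately have "F \<inter> UNIV \<times> R \<in> assignments (C - F\<inverse> `` {r}) R d"
      using FD(4) by (auto simp: assignments_def)
    moreover have "F\<inverse> `` {r} \<subseteq> C" using FD(1) by auto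
    ultimately show "?g F \<in> Sigma ?SS (\<lambda>S. assignments (C - S) R d)" using FD(4) by simp
  qed
  have "card (assignments C (insert r R) d) \<le> card (Sigma ?SS (\<lambda>S. assignments (C - S) R d))"
    using insert.prems insert.hyps(1) fSS
    by (intro card_inj_on_le[OF inj im] finite_SigmaI) (auto intro: finite_assignments)
  also have "\<dots> = (\<Sum>S\<in>?SS. card (assignments (C - S) R d))"
    using insert.prems insert.hyps(1) fSS by (intro card_SigmaI) (auto intro: finite_assignments)
  finally have "card (assignments C (insert r R) d) * (\<Prod>i\<in>insert r R. fact (d i))
      \<le> (\<Sum>S\<in>?SS. card (assignments (C - S) R d)) * (\<Prod>i\<in>insert r R. fact (d i))"
    by (rule mult_right_mono) simp
  also have "\<dots> = (\<Sum>S\<in>?SS. fact (d r) * (card (assignments (C - S) R d) * (\<Prod>i\<in>R. fact (d i))))"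
    using insert.hyps by (simp add: sum_distrib_right sum_distrib_left mult_ac)
  also have "\<dots> \<le> (\<Sum>S\<in>?SS. fact (d r) * fact (card C - d r))"
  proof (intro sum_mono mult_left_mono)
    fix S assume S: "S \<in> ?SS"
    then have "card (C - S) = card C - d r"
      using insert.prems by (auto simp: card_Diff_subset finite_subset)
    then show "card (assignments (C - S) R d) * (\<Prod>i\<in>R. fact (d i)) \<le> fact (card C - d r)"
      using insert.IH[of "C - S"] insert.prems by simp
  qed simp
  also have "\<dots> = (card C choose d r) * (fact (d r) * fact (card C - d r))"
    using n_subsets[OF insert.prems] by simp
  also have "\<dots> \<le> fact (card C)"
    using binomial_fact_lemma[of "d r" "card C"] by (cases "d r \<le> card C") (auto simp: mult_ac binomial_eq_0)
  finally show ?case .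
qed

lemma card_first_generation:
  assumes "finite R" "finite B" "E \<in> parent_forests R B d"
  shows "card (E\<inverse> `` R) = (\<Sum>i\<in>R. d i)"
proof -
  have E: "E \<subseteq> B \<times> (R \<union> B)" "single_valued E" "\<And>i. i \<in> R \<Longrightarrow> card (E\<inverse> `` {i}) = d i"
    using assms(3) by (auto simp: parent_forests_def)
  have "finite (E\<inverse> `` {i})" for i using E(1) assms(2) by (auto intro: finite_subset[of _ B])
  then have "card (\<Union>i\<in>R. E\<inverse> `` {i}) = (\<Sum>i\<in>R. card (E\<inverse> `` {i}))"
    using assms(1) E(2) by (intro card_UN_disjoint) (auto simp: single_valued_def)
  moreover have "E\<inverse> `` R = (\<Union>i\<in>R. E\<inverse> `` {i})" by auto
  ultimately show ?thesis using E(3) by simp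
qed

text \<open>
  Splitting off the first generation \<open>C\<close>: for a forest with roots \<open>R\<close>, the vertices whose parent is a
  root are the roots of what is left when \<open>R\<close> is removed.
\<close>

lemma card_parent_forests_split_le:
  fixes d :: "'a \<Rightarrow> nat"
  assumes "finite R" "finite B" "R \<inter> B = {}"
    and step: "\<And>E. E \<in> parent_forests R B d \<Longrightarrow> P E \<Longrightarrow> Q (E\<inverse> `` R) (E \<inter> UNIV \<times> B)"
  shows "card {E \<in> parent_forests R B d. P E} * (\<Prod>i\<in>R. fact (d i))
    \<le> fact (\<Sum>i\<in>R. d i) * (\<Sum>C\<in>{C. C \<subseteq> B \<and> card C = (\<Sum>i\<in>R. d i)}.
        card {E \<in> parent_forests C (B - C) d. Q C E})"
proof -
  let ?c = "\<Sum>i\<in>R. d i"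
  let ?CC = "{C. C \<subseteq> B \<and> card C = ?c}"
  let ?K = "\<lambda>C. {E \<in> parent_forests C (B - C) d. Q C E}"
  let ?g = "\<lambda>E. (E\<inverse> `` R, (E \<inter> UNIV \<times> R, E \<inter> UNIV \<times> B))"
  let ?X = "{E \<in> parent_forests R B d. P E}"
  have fCC: "finite ?CC" using assms(2) by auto
  have fin: "finite (assignments C R d \<times> ?K C)" if "C \<in> ?CC" for C
    using that assms(1,2) by (auto intro!: finite_cartesian_product finite_assignments
      finite_subset[OF Collect_subset finite_parent_forests] simp: finite_subset)
  \<comment> \<open>An upper bound uses only that a forest can be recovered from its two
    parts.\<close>
  have inj: "inj_on ?g ?X"
  proof (rule inj_onI)
    fix E E' assume E: "E \<in> ?X" "E' \<in> ?X" and eq: "?g E = ?g E'"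
    have dec: "F = F \<inter> UNIV \<times> R \<union> F \<inter> UNIV \<times> B" if "F \<in> ?X" for F
      using that by (auto simp: parent_forests_def)
    have "E = E \<inter> UNIV \<times> R \<union> E \<inter> UNIV \<times> B" by (rule dec[OF E(1)])
    also have "\<dots> = E' \<inter> UNIV \<times> R \<union> E' \<inter> UNIV \<times> B" using eq by simp
    also have "\<dots> = E'" by (rule dec[OF E(2), symmetric])
    finally show "E = E'" .
  qed
  have im: "?g ` ?X \<subseteq> Sigma ?CC (\<lambda>C. assignments C R d \<times> ?K C)"
  proof (rule image_subsetI)
    fix E assume E: "E \<in> ?X"
    then have Ep: "E \<in> parent_forests R B d" "P E" by auto
    then have ED: "E \<subseteq> B \<times> (R \<union> B)" "Domain E = B" "single_valued E" "acyclic E"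
      "\<And>i. i \<in> R \<union> B \<Longrightarrow> card (E\<inverse> `` {i}) = d i" by (auto simp: parent_forests_def)
    let ?C = "E\<inverse> `` R"
    have CB: "?C \<subseteq> B" using ED(1) by auto
    have cC: "card ?C = ?c" by (rule card_first_generation[OF assms(1,2) Ep(1)])
    have "(E \<inter> UNIV \<times> R)\<inverse> `` {i} = E\<inverse> `` {i}" if "i \<in> R" for i using that by auto
    then have 1: "E \<inter> UNIV \<times> R \<in> assignments ?C R d"
      using ED(3,5) by (auto simp: assignments_def single_valued_def)
    have no: "(u, j) \<notin> E" if "u \<in> ?C" "j \<in> B" for u j
      using that ED(3) assms(3) unfolding single_valued_def by blast
    then have "E \<inter> UNIV \<times> B \<subseteq> (B - ?C) \<times> (?C \<union> (B - ?C))"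
      using ED(1) by blast
    moreover have "Domain (E \<inter> UNIV \<times> B) = B - ?C"
      using no ED(1,2) by blast
    moreover have "single_valued (E \<inter> UNIV \<times> B)" using ED(3) by (auto simp: single_valued_def)
    moreover have "acyclic (E \<inter> UNIV \<times> B)" by (rule acyclic_subset[OF ED(4)]) auto
    moreover have "card ((E \<inter> UNIV \<times> B)\<inverse> `` {i}) = d i" if "i \<in> ?C \<union> (B - ?C)" for i
    proof -
      have "i \<in> B" using that CB by auto
      moreover from this have "(E \<inter> UNIV \<times> B)\<inverse> `` {i} = E\<inverse> `` {i}" by auto
      ultimately show ?thesis using ED(5) by simp
    qed
    ultimately have "E \<inter> UNIV \<times> B \<in> parent_forests ?C (B - ?C) d"
      unfolding parent_forests_def by simp
    then show "?g E \<in> Sigma ?CC (\<lambda>C. assignments C R d \<times> ?K C)"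
      using 1 CB cC step[OF Ep] by simp
  qed
  have "card ?X \<le> card (Sigma ?CC (\<lambda>C. assignments C R d \<times> ?K C))"
    by (intro card_inj_on_le[OF inj im] finite_SigmaI fCC fin)
  also have "\<dots> = (\<Sum>C\<in>?CC. card (assignments C R d) * card (?K C))"
    using fCC fin by (subst card_SigmaI) (auto simp: card_cartesian_product)
  finally have "card ?X * (\<Prod>i\<in>R. fact (d i))
      \<le> (\<Sum>C\<in>?CC. card (assignments C R d) * card (?K C)) * (\<Prod>i\<in>R. fact (d i))"
    by (rule mult_right_mono) simp
  also have "\<dots> = (\<Sum>C\<in>?CC. (card (assignments C R d) * (\<Prod>i\<in>R. fact (d i))) * card (?K C))"
    unfolding sum_distrib_right by (simp only: mult_ac)
  also have "\<dots> \<le> (\<Sum>C\<in>?CC. fact ?c * card (?K C))"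
  proof (intro sum_mono mult_right_mono)
    fix C assume "C \<in> ?CC"
    then show "card (assignments C R d) * (\<Prod>i\<in>R. fact (d i)) \<le> fact ?c"
      using card_assignments_le[OF assms(1), of C d] assms(2) by (auto simp: finite_subset)
  qed simp
  finally show ?thesis by (simp add: sum_distrib_left)
qed

text \<open>
  In the breadth-first exploration of a random forest, \<open>B\<close> is the set of vertices still to be placed and
  \<open>q\<close> the number of child slots still to be filled; placing \<open>x\<close> fills one slot and opens \<open>d x\<close> new ones.
  The functions below are supersolutions of the corresponding recursion.
\<close>

definition exploration_superharmonic :: "('a \<Rightarrow> nat) \<Rightarrow> ('a set \<Rightarrow> nat \<Rightarrow> real) \<Rightarrow> bool" where
  "exploration_superharmonic d F \<longleftrightarrow> (\<forall>B r. finite B \<longrightarrow> (\<Sum>i\<in>B. d i) + Suc r = card B \<longrightarrow>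
     (\<Sum>x\<in>B. F (B - {x}) (r + d x)) \<le> F B (Suc r))"

section \<open>Comparing forest counts with superharmonic functions\<close>

lemma sum_subsets_Suc_card:
  fixes G :: "'a set \<Rightarrow> real"
  assumes "finite B"
  shows "real (Suc j) * (\<Sum>C\<in>{C. C \<subseteq> B \<and> card C = Suc j}. G C)
    = (\<Sum>C\<in>{C. C \<subseteq> B \<and> card C = j}. \<Sum>x\<in>B - C. G (insert x C))"
proof -
  let ?S = "\<lambda>j. {C. C \<subseteq> B \<and> card C = j}"
  have fin: "finite C" if "C \<in> ?S j" for C j using that assms by (auto intro: finite_subset)
  have fS: "finite (?S j)" for j using assms by auto
  \<comment> \<open>Both sides count pairs of a set with \<open>Suc j\<close> elements and a
    distinguished element, seen as the last one inserted.\<close>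
  have "real (Suc j) * (\<Sum>C\<in>?S (Suc j). G C) = (\<Sum>C\<in>?S (Suc j). \<Sum>x\<in>C. G C)"
    by (simp add: sum_distrib_left)
  also have "\<dots> = (\<Sum>(C, x)\<in>Sigma (?S (Suc j)) (\<lambda>C. C). G C)"
    by (rule sum.Sigma) (use fS fin in blast)+
  also have "\<dots> = (\<Sum>(C, x)\<in>Sigma (?S j) (\<lambda>C. B - C). G (insert x C))"
  proof (rule sum.reindex_bij_witness[of _ "\<lambda>(C, x). (insert x C, x)" "\<lambda>(C, x). (C - {x}, x)"])
    let ?i = "\<lambda>(C, x). (insert x C, x)" and ?j = "\<lambda>(C, x). (C - {x}, x)"
    show "?i (?j a) = a" if "a \<in> Sigma (?S (Suc j)) (\<lambda>C. C)" for a
      using that by (cases a) (simp add: insert_absorb)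
    show "?j a \<in> Sigma (?S j) (\<lambda>C. B - C)" if "a \<in> Sigma (?S (Suc j)) (\<lambda>C. C)" for a
    proof -
      obtain C x where "a = (C, x)" by (cases a)
      with that have a: "a = (C, x)" "C \<subseteq> B" "card C = Suc j" "x \<in> C" by simp_all
      then have "card (C - {x}) = j" by (simp add: card_Diff_singleton)
      then show ?thesis using a by (simp add: subset_iff)
    qed
    show "?j (?i b) = b" if "b \<in> Sigma (?S j) (\<lambda>C. B - C)" for b
      using that by (cases b) simp
    show "?i b \<in> Sigma (?S (Suc j)) (\<lambda>C. C)" if "b \<in> Sigma (?S j) (\<lambda>C. B - C)" for b
    proof -
      obtain C x where "b = (C, x)" by (cases b)
      with that have b: "b = (C, x)" "C \<subseteq> B" "card C = j" "x \<in> B" "x \<notin> C" by simp_all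
      moreover have "finite C" using b(2) assms by (rule finite_subset)
      ultimately have "card (insert x C) = Suc j" by simp
      then show ?thesis using b by simp
    qed
    show "(case ?j a of (C, x) \<Rightarrow> G (insert x C)) = (case a of (C, x) \<Rightarrow> G C)"
      if "a \<in> Sigma (?S (Suc j)) (\<lambda>C. C)" for a
      using that by (cases a) (simp add: insert_absorb)
  qed
  also have "\<dots> = (\<Sum>C\<in>?S j. \<Sum>x\<in>B - C. G (insert x C))"
    by (rule sum.Sigma[symmetric]) (use fS assms in blast)+
  finally show ?thesis .
qed

text \<open>The one-step inequality is applied \<open>j\<close> times, once per placed vertex;
  \<open>fact j\<close> accounts for the orders of placement, since \<open>C\<close> is unordered.
  With \<open>j = c\<close> one whole generation has been placed and the open slots are exactly
  those of its members.\<close>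

lemma exploration_superharmonic_iterate:
  assumes F: "exploration_superharmonic d F" and "finite B" "(\<Sum>i\<in>B. d i) + c = card B" "j \<le> c"
  shows "fact j * (\<Sum>C\<in>{C. C \<subseteq> B \<and> card C = j}. F (B - C) (c - j + (\<Sum>i\<in>C. d i))) \<le> F B c"
  using assms(4)
proof (induction j)
  case 0
  have "{C. C \<subseteq> B \<and> card C = 0} = {{}}" using assms(2) by (auto simp: finite_subset)
  then show ?case by simp
next
  case (Suc j)
  let ?S = "\<lambda>j. {C. C \<subseteq> B \<and> card C = j}"
  let ?G = "\<lambda>C. F (B - C) (c - Suc j + (\<Sum>i\<in>C. d i))"
  have "fact (Suc j) * (\<Sum>C\<in>?S (Suc j). ?G C) = fact j * (\<Sum>C\<in>?S j. \<Sum>x\<in>B - C. ?G (insert x C))"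
    by (subst sum_subsets_Suc_card[OF assms(2), of j ?G, symmetric]) (simp only: fact_Suc mult_ac)
  also have "\<dots> \<le> fact j * (\<Sum>C\<in>?S j. F (B - C) (c - j + (\<Sum>i\<in>C. d i)))"
  proof (intro mult_left_mono sum_mono)
    fix C assume "C \<in> ?S j"
    then have C: "C \<subseteq> B" "card C = j" "finite C" using assms(2) by (auto intro: finite_subset)
    let ?r = "c - Suc j + (\<Sum>i\<in>C. d i)"
    have "(\<Sum>i\<in>B. d i) = (\<Sum>i\<in>B - C. d i) + (\<Sum>i\<in>C. d i)"
      by (rule sum.subset_diff[OF C(1) assms(2)])
    moreover have "card (B - C) = card B - j" using C by (simp add: card_Diff_subset)
    ultimately have "(\<Sum>i\<in>B - C. d i) + Suc ?r = card (B - C)" using assms(3) Suc.prems by simp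
    then have "(\<Sum>x\<in>B - C. F (B - C - {x}) (?r + d x)) \<le> F (B - C) (Suc ?r)"
      using F assms(2) unfolding exploration_superharmonic_def by blast
    moreover have "(\<Sum>x\<in>B - C. ?G (insert x C)) = (\<Sum>x\<in>B - C. F (B - C - {x}) (?r + d x))"
    proof (rule sum.cong[OF refl])
      fix x assume "x \<in> B - C"
      moreover have "B - insert x C = B - C - {x}" by blast
      ultimately show "?G (insert x C) = F (B - C - {x}) (?r + d x)" using C(3) by (simp add: ac_simps)
    qed
    moreover have "Suc ?r = c - j + (\<Sum>i\<in>C. d i)" using Suc.prems by simp
    ultimately show "(\<Sum>x\<in>B - C. ?G (insert x C)) \<le> F (B - C) (c - j + (\<Sum>i\<in>C. d i))" by metis
  qed simp
  also have "\<dots> \<le> F B c" using Suc by simp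
  finally show ?case .
qed

text \<open>Optional stopping in counting form. Where the stopping rule \<open>S\<close> holds,
  \<open>F\<close> must dominate the weighted count outright; elsewhere the event \<open>P\<close>
  has to pass on to what remains below the roots. Splitting off the first generation yields
  \<open>fact c\<close> times a sum over \<open>C\<close>, exactly what
  \<open>exploration_superharmonic_iterate\<close> absorbs for \<open>j = c\<close>. Positivity of
  \<open>c\<close> makes \<open>B\<close> shrink.\<close>

lemma card_parent_forests_le:
  fixes F :: "'a set \<Rightarrow> nat \<Rightarrow> real"
  assumes F: "exploration_superharmonic d F"
    and stop: "\<And>R B. \<lbrakk>finite R; finite B; R \<inter> B = {}; (\<Sum>i\<in>R \<union> B. d i) = card B; S R B\<rbrakk>
      \<Longrightarrow> real (card {E \<in> parent_forests R B d. P R E} * (\<Prod>i\<in>R \<union> B. fact (d i))) \<le> F B (\<Sum>i\<in>R. d i)"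
    and pass: "\<And>R B E. \<lbrakk>finite R; finite B; R \<inter> B = {}; \<not> S R B; E \<in> parent_forests R B d; P R E\<rbrakk>
      \<Longrightarrow> (\<Sum>i\<in>R. d i) > 0 \<and> P (E\<inverse> `` R) (E \<inter> UNIV \<times> B)"
    and nonneg: "\<And>B q. F B q \<ge> 0"
    and "finite R" "finite B" "R \<inter> B = {}" "(\<Sum>i\<in>R \<union> B. d i) = card B"
  shows "real (card {E \<in> parent_forests R B d. P R E} * (\<Prod>i\<in>R \<union> B. fact (d i))) \<le> F B (\<Sum>i\<in>R. d i)"
  using assms(5-)
proof (induction "card B" arbitrary: R B rule: less_induct)
  case less
  note h = less.prems
  let ?c = "\<Sum>i\<in>R. d i"
  let ?CC = "{C. C \<subseteq> B \<and> card C = ?c}"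
  let ?X = "{E \<in> parent_forests R B d. P R E}"
  show ?case
  proof (cases "S R B \<or> ?X = {}")
    case True
    then show ?thesis
    proof
      assume "?X = {}"
      then have "card ?X = 0" by (simp only: card.empty)
      then show ?thesis using nonneg by simp
    qed (rule stop[OF h])
  next
    case False
    then have c0: "?c > 0" using pass[OF h(1-3)] by blast
    have sB: "(\<Sum>i\<in>B. d i) + ?c = card B" using h by (simp add: sum.union_disjoint)
    have "card ?X * (\<Prod>i\<in>R. fact (d i)) \<le> fact ?c * (\<Sum>C\<in>?CC. card {E \<in> parent_forests C (B - C) d. P C E})"
      by (rule card_parent_forests_split_le[OF h(1-3)]) (use False pass[OF h(1-3)] in blast)
    then have "(card ?X * (\<Prod>i\<in>R. fact (d i))) * (\<Prod>i\<in>B. fact (d i))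
        \<le> (fact ?c * (\<Sum>C\<in>?CC. card {E \<in> parent_forests C (B - C) d. P C E})) * (\<Prod>i\<in>B. fact (d i))"
      by (rule mult_right_mono) simp
    also have "\<dots> = fact ?c * (\<Sum>C\<in>?CC. card {E \<in> parent_forests C (B - C) d. P C E} * (\<Prod>i\<in>B. fact (d i)))"
      by (simp only: sum_distrib_right mult.assoc)
    also have "(card ?X * (\<Prod>i\<in>R. fact (d i))) * (\<Prod>i\<in>B. fact (d i)) = card ?X * (\<Prod>i\<in>R \<union> B. fact (d i))"
      using h(1-3) by (simp add: prod.union_disjoint)
    finally have "real (card ?X * (\<Prod>i\<in>R \<union> B. fact (d i)))
        \<le> real (fact ?c * (\<Sum>C\<in>?CC. card {E \<in> parent_forests C (B - C) d. P C E} * (\<Prod>i\<in>B. fact (d i))))"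
      by (rule of_nat_mono)
    also have "\<dots> = fact ?c * (\<Sum>C\<in>?CC. real (card {E \<in> parent_forests C (B - C) d. P C E} * (\<Prod>i\<in>B. fact (d i))))"
      by simp
    also have "\<dots> \<le> fact ?c * (\<Sum>C\<in>?CC. F (B - C) (\<Sum>i\<in>C. d i))"
    proof (intro mult_left_mono sum_mono)
      fix C assume C: "C \<in> ?CC"
      then have fC: "finite C" using h(2) by (auto intro: finite_subset)
      have CB: "C \<union> (B - C) = B" using C by auto
      have cB: "card (B - C) = card B - ?c" using C fC by (simp add: card_Diff_subset)
      have "real (card {E \<in> parent_forests C (B - C) d. P C E} * (\<Prod>i\<in>C \<union> (B - C). fact (d i)))
          \<le> F (B - C) (\<Sum>i\<in>C. d i)"
      proof (rule less.hyps)
        show "card (B - C) < card B" using cB c0 sB by linarith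
        show "(\<Sum>i\<in>C \<union> (B - C). d i) = card (B - C)" unfolding CB cB using sB by linarith
      qed (use fC h(2) in auto)
      then show "real (card {E \<in> parent_forests C (B - C) d. P C E} * (\<Prod>i\<in>B. fact (d i)))
          \<le> F (B - C) (\<Sum>i\<in>C. d i)" unfolding CB .
    qed simp
    also have "\<dots> \<le> F B ?c"
      using exploration_superharmonic_iterate[OF F h(2) sB order_refl] by simp
    finally show ?thesis .
  qed
qed

text \<open>This is the weighted number of completions, and the inequality is in fact an equality:
  \<open>r + d x\<close> sums over \<open>B\<close> to \<open>Suc r * (card B - 1)\<close>. The
  empty set needs its own value, since the exploration ends there with no open slot while one
  completion, the empty forest, exists.\<close>

lemma exploration_superharmonic_count:
  "exploration_superharmonic d (\<lambda>B q. if B = {} then 1 else real q * fact (card B - 1))"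
  unfolding exploration_superharmonic_def
proof (intro allI impI)
  fix B :: "'a set" and r :: nat
  assume fin: "finite B" and s: "(\<Sum>i\<in>B. d i) + Suc r = card B"
  define m where "m = card B - 1"
  have m: "card B = Suc m" using s by (simp add: m_def)
  have "B \<noteq> {}" using s by auto
  show "(\<Sum>x\<in>B. if B - {x} = {} then 1 else real (r + d x) * fact (card (B - {x}) - 1))
      \<le> (if B = {} then 1 else real (Suc r) * fact (card B - 1))"
  proof (cases m)
    case 0
    then obtain x where "B = {x}" using m card_1_singletonE[of B] by auto
    then show ?thesis by simp
  next
    case (Suc k)
    have c: "card (B - {x}) = Suc k" if "x \<in> B" for x using m Suc that fin by (simp add: card_Diff_singleton)
    have "(\<Sum>x\<in>B. if B - {x} = {} then 1 else real (r + d x) * fact (card (B - {x}) - 1))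
        = (\<Sum>x\<in>B. real (r + d x) * fact k)"
    proof (rule sum.cong[OF refl])
      fix x assume "x \<in> B"
      from c[OF this] show "(if B - {x} = {} then 1 else real (r + d x) * fact (card (B - {x}) - 1))
          = real (r + d x) * fact k" by (metis card.empty diff_Suc_1 nat.distinct(1))
    qed
    also have "\<dots> = real (\<Sum>x\<in>B. r + d x) * fact k" by (simp only: of_nat_sum sum_distrib_right)
    also have "(\<Sum>x\<in>B. r + d x) = Suc r * Suc k"
      using s m Suc by (simp add: sum.distrib algebra_simps)
    also have "real (Suc r * Suc k) * fact k = real (Suc r) * fact (card B - 1)"
      using m Suc by (simp add: algebra_simps)
    finally show ?thesis using \<open>B \<noteq> {}\<close> by simp
  qed
qed

text \<open>
  A Lyapunov function: relative to the number of completions \<open>q (|B| - 1)!\<close>, it bounds the square of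
  the largest generation from the current state on.
\<close>

definition width_potential :: "('a \<Rightarrow> nat) \<Rightarrow> 'a set \<Rightarrow> nat \<Rightarrow> real" where
  "width_potential d B q = real q * fact (card B - 1)
     * ((real q)\<^sup>2 + 5 * (\<Sum>i\<in>B. real (d i) * (real (d i) - 1)))"

text \<open>With \<open>v x = d x * (d x - 1)\<close>, expanding the cube by
  \<open>(d x)\<^sup>2 = v x + d x\<close> produces \<open>3 R v x\<close>, and the removal of
  \<open>x\<close> from the sum produces \<open>- 5 R v x\<close>, which leaves
  \<open>- 2 R v x\<close>. The part \<open>v x - 4 d x v x\<close> is not positive because
  \<open>v x\<close> vanishes unless \<open>d x \<ge> 2\<close>. Summed over \<open>B\<close>, the
  other terms match the value at \<open>Suc r\<close> up to a nonpositive remainder.\<close>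

lemma exploration_superharmonic_width_potential: "exploration_superharmonic d (width_potential d)"
  unfolding exploration_superharmonic_def
proof (intro allI impI)
  fix B :: "'a set" and r :: nat
  assume fin: "finite B" and s: "(\<Sum>i\<in>B. d i) + Suc r = card B"
  define m where "m = card B - 1"
  have m: "card B = Suc m" using s by (simp add: m_def)
  define v where "v = (\<lambda>i. real (d i) * (real (d i) - 1))"
  have v: "real (d i) * (real (d i) - 1) = v i" for i by (simp add: v_def)
  define U where "U = (\<Sum>i\<in>B. v i)"
  define R where "R = real r"
  have v0: "v i \<ge> 0" for i by (cases "d i") (auto simp: v_def)
  then have U0: "U \<ge> 0" by (simp add: U_def sum_nonneg)
  have R0: "R \<ge> 0" by (simp add: R_def)
  show "(\<Sum>x\<in>B. width_potential d (B - {x}) (r + d x)) \<le> width_potential d B (Suc r)"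
  proof (cases m)
    case 0
    then obtain x where "B = {x}" using m card_1_singletonE[of B] by auto
    moreover from this s have "r = 0" "d x = 0" by auto
    ultimately show ?thesis by (simp add: width_potential_def)
  next
    case (Suc k)
    have S: "(\<Sum>x\<in>B. real (d x)) = real k + 1 - R"
      using arg_cong[OF s, of real] m Suc by (simp add: R_def)
    have card: "real (card B) = real k + 2" using m Suc by simp
    have wp: "width_potential d (B - {x}) (r + d x)
        = fact k * ((R + real (d x)) * ((R + real (d x))\<^sup>2 + 5 * (U - v x)))" if "x \<in> B" for x
    proof -
      have "card (B - {x}) - 1 = k" using m Suc that fin by (simp add: card_Diff_singleton)
      moreover have "(\<Sum>i\<in>B - {x}. v i) = U - v x" using fin that by (simp add: U_def sum_diff1)
      ultimately show ?thesis by (simp add: width_potential_def R_def v)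
    qed
    have term_le: "(R + real (d x)) * ((R + real (d x))\<^sup>2 + 5 * (U - v x))
        \<le> R ^ 3 + 5 * R * U + (3 * R\<^sup>2 + 3 * R + 1 + 5 * U) * real (d x) - 2 * R * v x" for x
    proof -
      have "real (d x) * v x \<ge> 2 * v x \<or> v x = 0"
      proof (cases "d x \<le> 1")
        case True
        then show ?thesis by (cases "d x") (auto simp: v_def)
      next
        case False
        then show ?thesis using v0[of x] by (auto intro!: mult_right_mono)
      qed
      then have *: "7 * v x \<le> 4 * (real (d x) * v x)" using v0[of x] by auto
      have "(R + real (d x)) * ((R + real (d x))\<^sup>2 + 5 * (U - v x))
        = R ^ 3 + 5 * R * U + (3 * R\<^sup>2 + 3 * R + 1 + 5 * U) * real (d x)
          - 2 * R * v x + v x - 4 * (real (d x) * v x)"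
        unfolding v_def by (simp add: power2_eq_square power3_eq_cube algebra_simps)
      then show ?thesis using * v0[of x] by linarith
    qed
    have "(\<Sum>x\<in>B. width_potential d (B - {x}) (r + d x))
        = fact k * (\<Sum>x\<in>B. (R + real (d x)) * ((R + real (d x))\<^sup>2 + 5 * (U - v x)))"
      using wp by (simp add: sum_distrib_left)
    also have "\<dots> \<le> fact k * (\<Sum>x\<in>B. R ^ 3 + 5 * R * U + (3 * R\<^sup>2 + 3 * R + 1 + 5 * U) * real (d x) - 2 * R * v x)"
      by (intro mult_left_mono sum_mono term_le) simp
    also have "(\<Sum>x\<in>B. R ^ 3 + 5 * R * U + (3 * R\<^sup>2 + 3 * R + 1 + 5 * U) * real (d x) - 2 * R * v x)
        = (real k + 2) * (R ^ 3 + 5 * R * U) + (3 * R\<^sup>2 + 3 * R + 1 + 5 * U) * (real k + 1 - R) - 2 * R * U"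
      by (simp only: sum.distrib sum_subtractf sum_constant card S[symmetric] sum_distrib_left[symmetric] U_def)
        (simp add: distrib_left)
    also have "(real k + 2) * (R ^ 3 + 5 * R * U) + (3 * R\<^sup>2 + 3 * R + 1 + 5 * U) * (real k + 1 - R) - 2 * R * U
        = (real k + 1) * ((R + 1) * ((R + 1)\<^sup>2 + 5 * U)) - (2 * R ^ 3 + 3 * R\<^sup>2 + R + 2 * R * U)"
      by (simp add: power2_eq_square power3_eq_cube algebra_simps)
    also have "\<dots> \<le> (real k + 1) * ((R + 1) * ((R + 1)\<^sup>2 + 5 * U))"
    proof -
      have "0 \<le> 2 * R ^ 3 + 3 * R\<^sup>2 + R + 2 * R * U"
        using R0 U0 by (intro add_nonneg_nonneg mult_nonneg_nonneg) auto
      then show ?thesis by linarith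
    qed
    also have "fact k * \<dots> = width_potential d B (Suc r)"
      using m Suc by (simp add: width_potential_def U_def v_def R_def algebra_simps)
    finally show ?thesis by simp
  qed
qed

section \<open>Tail bound for the width\<close>

lemma parent_forests_empty_roots:
  assumes "finite B" "B \<noteq> {}" shows "parent_forests {} B d = {}"
proof -
  have no: False if "E \<in> parent_forests {} B d" for E
  proof -
    have E: "E \<subseteq> B \<times> B" "Domain E = B" "single_valued E" "acyclic E"
      using that by (auto simp: parent_forests_def)
    have "finite E" using E(1) assms(1) by (meson finite_SigmaI finite_subset)
    obtain b where b: "b \<in> B" using assms(2) by auto
    obtain u where u: "u \<notin> Domain E" "(b, u) \<in> E\<^sup>*" using ex1_root[OF \<open>finite E\<close> E(3,4), of b] by blast
    have "u \<in> B" using u(2) b E(1) by induction auto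
    then show False using u(1) E(2) by simp
  qed
  show ?thesis by (rule equals0I) (rule no)
qed

lemma parent_forests_no_slots:
  assumes "finite R" "finite B" "R \<inter> B = {}" "(\<Sum>i\<in>R. d i) = 0" "B \<noteq> {}"
  shows "parent_forests R B d = {}"
proof -
  have no: False if E: "E \<in> parent_forests R B d" for E
  proof -
    have "card (E\<inverse> `` R) = 0" using card_first_generation[OF assms(1,2) E] assms(4) by simp
    moreover have EB: "E \<subseteq> B \<times> (R \<union> B)" using E by (simp add: parent_forests_def)
    then have "finite (E\<inverse> `` R)" using assms(2) by (auto intro: finite_subset[of _ B])
    ultimately have "E\<inverse> `` R = {}" by simp
    then have "E \<subseteq> B \<times> B" using EB by auto
    then have "E \<in> parent_forests {} B d" using E by (simp add: parent_forests_def)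
    then show False using parent_forests_empty_roots[OF assms(2,5)] by simp
  qed
  show ?thesis by (rule equals0I) (rule no)
qed

lemma card_all_parent_forests_le:
  assumes "finite R" "finite B" "R \<inter> B = {}" "(\<Sum>i\<in>R \<union> B. d i) = card B" "B \<noteq> {}"
  shows "real (card (parent_forests R B d) * (\<Prod>i\<in>R \<union> B. fact (d i)))
    \<le> real (\<Sum>i\<in>R. d i) * fact (card B - 1)"
proof -
  have "real (card {E \<in> parent_forests R B d. True} * (\<Prod>i\<in>R \<union> B. fact (d i)))
      \<le> (if B = {} then 1 else real (\<Sum>i\<in>R. d i) * fact (card B - 1))"
  proof (rule card_parent_forests_le[where S = "\<lambda>R B. B = {} \<or> (\<Sum>i\<in>R. d i) = 0"
        and F = "\<lambda>B q. if B = {} then 1 else real q * fact (card B - 1)" and P = "\<lambda>_ _. True",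
        OF exploration_superharmonic_count])
    fix R B :: "'a set"
    assume h: "finite R" "finite B" "R \<inter> B = {}" "(\<Sum>i\<in>R \<union> B. d i) = card B" "B = {} \<or> (\<Sum>i\<in>R. d i) = 0"
    show "real (card {E \<in> parent_forests R B d. True} * (\<Prod>i\<in>R \<union> B. fact (d i)))
        \<le> (if B = {} then 1 else real (\<Sum>i\<in>R. d i) * fact (card B - 1))"
    proof (cases "B = {}")
      case True
      have "E = {}" if "E \<in> parent_forests R B d" for E
        using that True by (simp add: parent_forests_def)
      then have "parent_forests R B d \<subseteq> {{}}" by blast
      then have "card (parent_forests R B d) \<le> card {{} :: ('a \<times> 'a) set}" by (intro card_mono) auto
      moreover have "(\<Prod>i\<in>R \<union> B. fact (d i)) = (1 :: nat)"
        using h(1,4) True by (intro prod.neutral) auto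
      ultimately show ?thesis using True by simp
    next
      case False
      then have "parent_forests R B d = {}" using parent_forests_no_slots[OF h(1-3)] h(5) by simp
      then show ?thesis using False by (simp del: of_nat_sum)
    qed
  qed (use assms in auto)
  then show ?thesis using assms(5) by simp
qed

text \<open>A maximal inequality: the exploration stops as soon as the next generation is known to
  have \<open>c \<ge> w\<close> members. The weighted number of completions is then at most
  \<open>c * fact (card B - 1)\<close>, and the term \<open>c\<^sup>2 \<ge> w\<^sup>2\<close> in the
  potential pays for the division by \<open>w\<^sup>2\<close>.\<close>

lemma card_wide_parent_forests_le:
  assumes "finite R" "finite B" "R \<inter> B = {}" "(\<Sum>i\<in>R \<union> B. d i) = card B" "real (card R) < w"
  shows "real (card {E \<in> parent_forests R B d. \<exists>h. w \<le> real (card ((E ^^ h)\<inverse> `` R))} * (\<Prod>i\<in>R \<union> B. fact (d i)))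
    \<le> width_potential d B (\<Sum>i\<in>R. d i) / w\<^sup>2"
proof -
  \<comment> \<open>The conjunct \<open>card R < w\<close> excludes the roots themselves as the wide
    generation, so that generation is still present after the roots are removed.\<close>
  let ?P = "\<lambda>R E. real (card R) < w \<and> (\<exists>h. w \<le> real (card ((E ^^ h)\<inverse> `` R)))"
  let ?F = "\<lambda>B q. width_potential d B q / w\<^sup>2"
  have w0: "w > 0" using assms(5) by (meson le_less_trans of_nat_0_le_iff)
  have pnn: "0 \<le> real (d i) * (real (d i) - 1)" for i by (cases "d i") auto
  have sh: "exploration_superharmonic d ?F"
    using exploration_superharmonic_width_potential[of d]
    by (auto simp: exploration_superharmonic_def intro!: divide_right_mono simp flip: sum_divide_distrib)
  have no_slots: False if h: "finite R" "finite B" "R \<inter> B = {}" "(\<Sum>i\<in>R. d i) = 0"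
      and E: "E \<in> parent_forests R B d" "?P R E" for R B E
  proof -
    have "B = {}" using parent_forests_no_slots[OF h] E(1) by blast
    then have "E = {}" using E(1) by (auto simp: parent_forests_def)
    obtain h where h: "w \<le> real (card ((E ^^ h)\<inverse> `` R))" using E(2) by blast
    have "(E ^^ h)\<inverse> `` R = (if h = 0 then R else {})" using \<open>E = {}\<close> by (cases h) auto
    then have "card ((E ^^ h)\<inverse> `` R) \<le> card R" by auto
    then show False using h E(2) by linarith
  qed
  have "real (card {E \<in> parent_forests R B d. ?P R E} * (\<Prod>i\<in>R \<union> B. fact (d i))) \<le> ?F B (\<Sum>i\<in>R. d i)"
  proof (rule card_parent_forests_le[where S = "\<lambda>R B. (\<Sum>i\<in>R. d i) = 0 \<or> w \<le> real (\<Sum>i\<in>R. d i)" and P = ?P, OF sh])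
    fix R B :: "'a set"
    assume h: "finite R" "finite B" "R \<inter> B = {}" "(\<Sum>i\<in>R \<union> B. d i) = card B"
      and stop: "(\<Sum>i\<in>R. d i) = 0 \<or> w \<le> real (\<Sum>i\<in>R. d i)"
    let ?c = "\<Sum>i\<in>R. d i"
    show "real (card {E \<in> parent_forests R B d. ?P R E} * (\<Prod>i\<in>R \<union> B. fact (d i))) \<le> ?F B ?c"
    proof (cases "?c = 0")
      case True
      have "{E \<in> parent_forests R B d. ?P R E} = {}" using no_slots[OF h(1-3) True] by blast
      then have "card {E \<in> parent_forests R B d. ?P R E} = 0" by (simp only: card.empty)
      then show ?thesis unfolding True by (simp add: width_potential_def)
    next
      case False
      with stop have wc: "w \<le> real ?c" by blast
      have "?c \<le> card B" using h(4) sum.union_disjoint[OF h(1-3), of d] by linarith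
      with False have B0: "B \<noteq> {}" by (metis card.empty le_zero_eq)
      have "card {E \<in> parent_forests R B d. ?P R E} \<le> card (parent_forests R B d)"
        by (rule card_mono[OF finite_parent_forests[OF h(1,2)] Collect_subset])
      then have "real (card {E \<in> parent_forests R B d. ?P R E} * (\<Prod>i\<in>R \<union> B. fact (d i)))
          \<le> real (card (parent_forests R B d) * (\<Prod>i\<in>R \<union> B. fact (d i)))"
        by (intro of_nat_mono mult_right_mono) auto
      also have "\<dots> \<le> real ?c * fact (card B - 1)" by (rule card_all_parent_forests_le[OF h B0])
      also have "\<dots> \<le> ?F B ?c"
      proof -
        have "w\<^sup>2 \<le> (real ?c)\<^sup>2" using wc w0 by (intro power_mono) auto
        also have "\<dots> \<le> (real ?c)\<^sup>2 + 5 * (\<Sum>i\<in>B. real (d i) * (real (d i) - 1))"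
          using sum_nonneg[of B "\<lambda>i. real (d i) * (real (d i) - 1)", OF pnn] by linarith
        finally have "real ?c * fact (card B - 1) * w\<^sup>2 \<le> width_potential d B ?c"
          unfolding width_potential_def by (intro mult_left_mono) (simp_all del: of_nat_sum)
        then show ?thesis using w0 by (simp add: pos_le_divide_eq)
      qed
      finally show ?thesis .
    qed
  next
    fix R B :: "'a set" and E
    assume h: "finite R" "finite B" "R \<inter> B = {}" "\<not> ((\<Sum>i\<in>R. d i) = 0 \<or> w \<le> real (\<Sum>i\<in>R. d i))"
      and E: "E \<in> parent_forests R B d" "?P R E"
    let ?C = "E\<inverse> `` R" and ?E = "E \<inter> UNIV \<times> B"
    have EB: "E \<subseteq> B \<times> (R \<union> B)" using E(1) unfolding parent_forests_def by (elim CollectE conjE)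
    have cC: "card ?C = (\<Sum>i\<in>R. d i)" by (rule card_first_generation[OF h(1,2) E(1)])
    obtain k where k: "w \<le> real (card ((E ^^ k)\<inverse> `` R))" using E(2) by (elim conjE exE)
    have "k \<noteq> 0"
    proof
      assume "k = 0"
      then have "(E ^^ k)\<inverse> `` R = R" by (simp only: relpow.simps converse_Id Image_Id)
      then show False using k E(2) by simp
    qed
    then obtain j where j: "k = Suc j" using not0_implies_Suc by blast
    \<comment> \<open>No arc leaves a root, so a path that ends in \<open>B\<close> never visits
      \<open>R\<close> and all its arcs survive the removal of \<open>R\<close>.\<close>
    have lift: "(v, x) \<in> ?E ^^ i" if "(v, x) \<in> E ^^ i" "x \<in> B" for v x i
      using that
    proof (induction i arbitrary: x)
      case (Suc i)
      then obtain y where y: "(v, y) \<in> E ^^ i" "(y, x) \<in> E" by auto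
      then have "(v, y) \<in> ?E ^^ i" using Suc.IH EB by blast
      then show ?case using y(2) Suc.prems(2) by auto
    qed simp
    have "(E ^^ k)\<inverse> `` R \<subseteq> (?E ^^ j)\<inverse> `` ?C"
    proof
      fix v assume "v \<in> (E ^^ k)\<inverse> `` R"
      then obtain u x where "(v, x) \<in> E ^^ j" "(x, u) \<in> E" "u \<in> R" unfolding j by auto
      then show "v \<in> (?E ^^ j)\<inverse> `` ?C" using lift[of v x j] EB by blast
    qed
    moreover have "finite ((?E ^^ j)\<inverse> `` ?C)"
    proof (rule finite_subset[OF _ finite_UnI[OF h(1,2)]])
      show "(?E ^^ j)\<inverse> `` ?C \<subseteq> R \<union> B"
      proof
        fix v assume "v \<in> (?E ^^ j)\<inverse> `` ?C"
        then obtain x where x: "(v, x) \<in> ?E ^^ j" "x \<in> ?C" by blast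
        show "v \<in> R \<union> B"
        proof (cases j)
          case 0
          then show ?thesis using x EB by auto
        next
          case (Suc i)
          then obtain y where "(v, y) \<in> ?E" using x(1) by (metis relpow_Suc_D2)
          then show ?thesis using EB by blast
        qed
      qed
    qed
    ultimately have "card ((E ^^ k)\<inverse> `` R) \<le> card ((?E ^^ j)\<inverse> `` ?C)" by (intro card_mono)
    then have "w \<le> real (card ((?E ^^ j)\<inverse> `` ?C))" using k by linarith
    then show "(\<Sum>i\<in>R. d i) > 0 \<and> ?P ?C ?E" using h(4) cC by auto
  next
    show "0 \<le> ?F B q" for B :: "'a set" and q
    proof -
      have "0 \<le> (\<Sum>i\<in>B. real (d i) * (real (d i) - 1))" by (intro sum_nonneg pnn)
      then show ?thesis by (simp add: width_potential_def)
    qed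
  qed (use assms in auto)
  then show ?thesis using assms(5) by simp
qed

text \<open>Choosing the root is itself one exploration step: it fills a single slot while all of
  \<open>V\<close> is still to be placed. Hence the potentials summed over \<open>r\<close> are at
  most the potential at \<open>q = 1\<close>, which supplies the factor one plus five times the
  sum.\<close>

lemma card_wide_parent_trees_le:
  assumes "finite V" "(\<Sum>i\<in>V. d i) + 1 = card V" "w > 1"
  shows "real (card {E \<in> parent_trees V d. \<exists>r\<in>V - Domain E. \<exists>h. w \<le> real (card ((E ^^ h)\<inverse> `` {r}))})
    \<le> (1 + 5 * (\<Sum>i\<in>V. real (d i * (d i - 1)))) / w\<^sup>2 * real (card (parent_trees V d))"
proof -
  let ?W = "\<lambda>E r. \<exists>h. w \<le> real (card ((E ^^ h)\<inverse> `` {r}))"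
  let ?B = "{E \<in> parent_trees V d. \<exists>r\<in>V - Domain E. ?W E r}"
  let ?K = "\<lambda>r. {E \<in> parent_forests {r} (V - {r}) d. ?W E r}"
  let ?F = "real (\<Prod>i\<in>V. fact (d i))"
  have sub: "?B \<subseteq> (\<Union>r\<in>V. ?K r)"
  proof
    fix E assume "E \<in> ?B"
    then obtain r where E: "E \<in> parent_trees V d" and r: "r \<in> V" "r \<notin> Domain E" "?W E r" by blast
    have EV: "E \<subseteq> V \<times> V" "single_valued E" "acyclic E" "\<And>i. i \<in> V \<Longrightarrow> card (E\<inverse> `` {i}) = d i"
      using E unfolding parent_trees_def by simp_all
    have "Domain E \<subseteq> V - {r}" using EV(1) r(2) by blast
    moreover have "card (Domain E) = card (V - {r})"
      using card_parent_tree[OF assms(1) E] card_Domain_single_valued[OF EV(2)] assms r(1) by simp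
    ultimately have D: "Domain E = V - {r}" using assms(1) by (intro card_subset_eq) auto
    have V: "{r} \<union> (V - {r}) = V" using r(1) by auto
    have "E \<subseteq> (V - {r}) \<times> V" using EV(1) D by blast
    then have "E \<in> parent_forests {r} (V - {r}) d"
      unfolding parent_forests_def V using D EV by simp
    then show "E \<in> (\<Union>r\<in>V. ?K r)" using r by blast
  qed
  have one: "real (card (?K r)) * ?F \<le> width_potential d (V - {r}) (d r) / w\<^sup>2" if "r \<in> V" for r
  proof -
    have V: "{r} \<union> (V - {r}) = V" using that by auto
    have "real (card (?K r) * (\<Prod>i\<in>{r} \<union> (V - {r}). fact (d i))) \<le> width_potential d (V - {r}) (\<Sum>i\<in>{r}. d i) / w\<^sup>2"
    proof (rule card_wide_parent_forests_le)
      show "(\<Sum>i\<in>{r} \<union> (V - {r}). d i) = card (V - {r})" unfolding V using assms that by simp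
    qed (use assms in auto)
    then show ?thesis unfolding V by simp
  qed
  have fK: "finite (?K r)" for r using assms(1) by (auto intro: finite_subset[OF Collect_subset finite_parent_forests])
  have "card ?B \<le> card (\<Union>r\<in>V. ?K r)" using sub assms(1) fK by (intro card_mono) auto
  also have "\<dots> \<le> (\<Sum>r\<in>V. card (?K r))" by (rule card_UN_le[OF assms(1)])
  finally have "real (card ?B) \<le> real (\<Sum>r\<in>V. card (?K r))" by (rule of_nat_mono)
  then have "real (card ?B) * ?F \<le> (\<Sum>r\<in>V. real (card (?K r))) * ?F"
    unfolding of_nat_sum by (rule mult_right_mono) (rule of_nat_0_le_iff)
  also have "\<dots> = (\<Sum>r\<in>V. real (card (?K r)) * ?F)" by (rule sum_distrib_right)
  also have "\<dots> \<le> (\<Sum>r\<in>V. width_potential d (V - {r}) (d r) / w\<^sup>2)" by (rule sum_mono) (rule one)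
  also have "\<dots> = (\<Sum>r\<in>V. width_potential d (V - {r}) (0 + d r)) / w\<^sup>2" by (simp add: sum_divide_distrib)
  also have "\<dots> \<le> width_potential d V (Suc 0) / w\<^sup>2"
  proof (rule divide_right_mono)
    have "(\<Sum>i\<in>V. d i) + Suc 0 = card V" using assms(2) by simp
    then show "(\<Sum>r\<in>V. width_potential d (V - {r}) (0 + d r)) \<le> width_potential d V (Suc 0)"
      by (rule exploration_superharmonic_width_potential[of d, unfolded exploration_superharmonic_def,
            rule_format, OF assms(1)])
  qed simp
  also have "\<dots> = (1 + 5 * (\<Sum>i\<in>V. real (d i * (d i - 1)))) / w\<^sup>2 * fact (card V - 1)"
  proof -
    have e: "real (d i) * (real (d i) - 1) = real (d i * (d i - 1))" for i
      by (cases "d i") (auto simp: algebra_simps)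
    show ?thesis unfolding width_potential_def e by simp
  qed
  also have "(fact (card V - 1) :: real) = real (card (parent_trees V d)) * ?F"
    using arg_cong[OF card_parent_trees[OF assms(1,2)], of real] by simp
  finally have "real (card ?B) * ?F
      \<le> ((1 + 5 * (\<Sum>i\<in>V. real (d i * (d i - 1)))) / w\<^sup>2 * real (card (parent_trees V d))) * ?F"
    by (simp only: mult.assoc)
  moreover have "?F > 0" by (simp add: prod_pos)
  ultimately show ?thesis by (simp only: mult_le_cancel_right_pos)
qed

section \<open>Graphs and parent relations\<close>

lemma awalk_length_iff:
  "(\<exists>p. pre_digraph.awalk (with_proj G) u p v \<and> length p = k) \<longleftrightarrow> u \<in> pverts G \<and> (u, v) \<in> parcs G ^^ k"
proof -
  have "(\<exists>p. set p \<subseteq> parcs G \<and> pcas u p v \<and> length p = k) \<longleftrightarrow> (u, v) \<in> parcs G ^^ k"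
  proof (induction k arbitrary: u)
    case 0
    show ?case by auto
  next
    case (Suc k)
    show ?case
    proof
      assume "\<exists>p. set p \<subseteq> parcs G \<and> pcas u p v \<and> length p = Suc k"
      then obtain e p where p: "set (e # p) \<subseteq> parcs G" "pcas u (e # p) v" "length p = k"
        by (metis length_Suc_conv)
      then have "(snd e, v) \<in> parcs G ^^ k" using Suc.IH[of "snd e"] by auto
      moreover have "(u, snd e) \<in> parcs G" using p by (cases e) auto
      ultimately show "(u, v) \<in> parcs G ^^ Suc k" by (rule relpow_Suc_I2[rotated])
    next
      assume "(u, v) \<in> parcs G ^^ Suc k"
      then obtain w where w: "(u, w) \<in> parcs G" "(w, v) \<in> parcs G ^^ k" by (meson relpow_Suc_D2)
      then obtain p where "set p \<subseteq> parcs G" "pcas w p v" "length p = k" using Suc.IH[of w] by blast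
      then show "\<exists>p. set p \<subseteq> parcs G \<and> pcas u p v \<and> length p = Suc k"
        using w(1) by (intro exI[of _ "(u, w) # p"]) auto
    qed
  qed
  then show ?thesis by (simp add: pre_digraph.awalk_def cas_with_proj_eq)
qed

lemma graph_dist_eq_LEAST: "u \<in> pverts G \<Longrightarrow> graph_dist G u v = (LEAST k. (u, v) \<in> parcs G ^^ k)"
  unfolding graph_dist_def awalk_length_iff by simp

lemma out_degree_with_proj: "out_degree (with_proj G) v = card (parcs G `` {v})"
proof -
  have "out_arcs (with_proj G) v = Pair v ` (parcs G `` {v})" by (auto simp: out_arcs_def)
  then show ?thesis by (simp add: out_degree_def card_image inj_on_def)
qed

lemma connected_with_proj_iff:
  assumes "sym (parcs G)" "parcs G \<subseteq> pverts G \<times> pverts G"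
  shows "Digraph_Component.connected (with_proj G) \<longleftrightarrow>
    pverts G \<noteq> {} \<and> (\<forall>u\<in>pverts G. \<forall>v\<in>pverts G. (u, v) \<in> (parcs G)\<^sup>*)"
proof -
  have "symcl (parcs G) = parcs G" using assms(1) by (auto simp: symcl_def sym_def)
  moreover have "(u, v) \<in> rtrancl_on (pverts G) (parcs G) \<longleftrightarrow> (u, v) \<in> (parcs G)\<^sup>*"
    if "u \<in> pverts G" "v \<in> pverts G" for u v
  proof
    assume "(u, v) \<in> (parcs G)\<^sup>*"
    then show "(u, v) \<in> rtrancl_on (pverts G) (parcs G)"
      by (rule rtrancl_consistent_rtrancl_on[OF _ that]) (use assms(2) in auto)
  qed (rule rtrancl_on_rtranclI)
  ultimately show ?thesis by (simp add: connected_conv)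
qed

definition graph_of_parents :: "'a set \<Rightarrow> ('a \<times> 'a) set \<Rightarrow> 'a pair_pre_digraph" where
  "graph_of_parents V E = \<lparr>pverts = V, parcs = E \<union> E\<inverse>\<rparr>"

lemma pair_graph_graph_of_parents:
  assumes "finite V" "E \<subseteq> V \<times> V" "acyclic E"
  shows "pair_graph (graph_of_parents V E)"
proof
  show "finite (parcs (graph_of_parents V E))"
    using assms by (auto simp: graph_of_parents_def intro: finite_subset[of _ "V \<times> V"])
  show "symmetric (with_proj (graph_of_parents V E))"
    by (auto simp: graph_of_parents_def Digraph.symmetric_def sym_def)
  show "fst e \<noteq> snd e" if "e \<in> parcs (graph_of_parents V E)" for e
  proof
    assume "fst e = snd e"
    then have "(fst e, fst e) \<in> E" using that by (cases e) (auto simp: graph_of_parents_def)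
    then show False using assms(3) by (auto simp: acyclic_def)
  qed
qed (use assms in \<open>auto simp: graph_of_parents_def\<close>)

lemma parent_tree_root:
  assumes "finite V" "(\<Sum>i\<in>V. d i) + 1 = card V" "E \<in> parent_trees V d"
  shows "\<exists>r\<in>V. Domain E = V - {r}"
proof -
  have E: "E \<subseteq> V \<times> V" "single_valued E" using assms(3) by (auto simp: parent_trees_def)
  have D: "Domain E \<subseteq> V" using E(1) by blast
  have "card (V - Domain E) = card V - card (Domain E)"
    using D assms(1) by (intro card_Diff_subset) (auto intro: finite_subset)
  also have "\<dots> = 1"
    using card_parent_tree[OF assms(1,3)] card_Domain_single_valued[OF E(2)] assms(2) by simp
  finally obtain r where "V - Domain E = {r}" by (rule card_1_singletonE)
  then show ?thesis using D by blast
qed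

lemma parent_tree_reaches_root:
  assumes "finite V" "E \<in> parent_trees V d" "Domain E = V - {r}" "v \<in> V"
  shows "(v, r) \<in> E\<^sup>*"
proof -
  have E: "E \<subseteq> V \<times> V" "single_valued E" "acyclic E" using assms(2) by (auto simp: parent_trees_def)
  have "finite E" using E(1) assms(1) by (meson finite_SigmaI finite_subset)
  obtain u where u: "u \<notin> Domain E" "(v, u) \<in> E\<^sup>*" using ex1_root[OF \<open>finite E\<close> E(2,3), of v] by blast
  have "u \<in> V" using u(2) assms(4) E(1) by induction auto
  then have "u = r" using u(1) assms(3) by blast
  then show ?thesis using u(2) by simp
qed

text \<open>From \<open>v\<close> a single-valued relation admits only one path of each length, so
  the longer path would have to continue through \<open>r\<close>, which has no outgoing
  arc.\<close>

lemma depth_unique: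
  assumes "single_valued E" "r \<notin> Domain E" "(v, r) \<in> E ^^ j" "(v, r) \<in> E ^^ k"
  shows "j = k"
proof -
  have "\<not> (j < k \<and> (v, r) \<in> E ^^ j \<and> (v, r) \<in> E ^^ k)" for j k
  proof
    assume h: "j < k \<and> (v, r) \<in> E ^^ j \<and> (v, r) \<in> E ^^ k"
    then have "E ^^ k = E ^^ j O E ^^ (k - j)" by (simp flip: relpow_add)
    with h obtain x where x: "(v, x) \<in> E ^^ j" "(x, r) \<in> E ^^ (k - j)" by blast
    have "x = r" using single_valued_relpow[OF assms(1), of j] x(1) h unfolding single_valued_def by blast
    moreover have "k - j = Suc (k - j - 1)" using conjunct1[OF h] by arith
    ultimately have "r \<in> Domain E" using x(2) by (metis DomainI relpow_Suc_D2)
    then show False using assms(2) by simp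
  qed
  then show ?thesis using assms(3,4) by (metis linorder_neqE_nat)
qed

text \<open>The path to the root, reversed, is a walk in the symmetrised graph. Conversely every
  step of a walk changes the depth by exactly one, so \<open>k\<close> steps from the root cannot
  reach depth greater than \<open>k\<close>.\<close>

lemma graph_dist_graph_of_parents:
  assumes "finite V" "E \<in> parent_trees V d" "r \<in> V" "Domain E = V - {r}" "v \<in> V"
  shows "graph_dist (graph_of_parents V E) r v = h \<longleftrightarrow> (v, r) \<in> E ^^ h"
proof -
  let ?A = "E \<union> E\<inverse>"
  have E: "E \<subseteq> V \<times> V" "single_valued E" using assms(2) by (auto simp: parent_trees_def)
  have rD: "r \<notin> Domain E" using assms(4) by simp
  have up: "(r, x) \<in> ?A ^^ k" if "(x, r) \<in> E ^^ k" for x k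
    using that
  proof (induction k arbitrary: x)
    case (Suc k)
    then obtain y where "(x, y) \<in> E" "(y, r) \<in> E ^^ k" by (meson relpow_Suc_D2)
    then have "(r, y) \<in> ?A ^^ k" "(y, x) \<in> ?A" using Suc.IH by simp_all
    then show ?case by (rule relpow_Suc_I)
  qed simp
  have down: "\<exists>j\<le>k. (x, r) \<in> E ^^ j" if "(r, x) \<in> ?A ^^ k" for x k
    using that
  proof (induction k arbitrary: x)
    case 0
    then show ?case by auto
  next
    case (Suc k)
    then obtain y where y: "(r, y) \<in> ?A ^^ k" "(y, x) \<in> ?A" by auto
    then obtain j where j: "j \<le> k" "(y, r) \<in> E ^^ j" using Suc.IH by blast
    show ?case
    proof (cases "(x, y) \<in> E")
      case True
      then have "(x, r) \<in> E ^^ Suc j" using j(2) by (rule relpow_Suc_I2)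
      then show ?thesis using j(1) by (metis Suc_le_mono)
    next
      case False
      then have yx: "(y, x) \<in> E" using y(2) by simp
      then have "y \<noteq> r" using rD by blast
      then obtain i where i: "j = Suc i" using j(2) by (cases j) auto
      then obtain z where "(y, z) \<in> E" "(z, r) \<in> E ^^ i" using j(2) by (metis relpow_Suc_D2)
      then have "(x, r) \<in> E ^^ i" using yx E(2) unfolding single_valued_def by blast
      then show ?thesis using i j(1) by (intro exI[of _ i]) simp
    qed
  qed
  obtain k where k: "(v, r) \<in> E ^^ k"
    using parent_tree_reaches_root[OF assms(1,2,4,5)] by (metis rtrancl_power)
  have "(LEAST k. (r, v) \<in> ?A ^^ k) = k"
  proof (rule Least_equality)
    show "(r, v) \<in> ?A ^^ k" by (rule up[OF k])
    fix m assume "(r, v) \<in> ?A ^^ m"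
    then obtain j where "j \<le> m" "(v, r) \<in> E ^^ j" using down by blast
    then show "k \<le> m" using depth_unique[OF E(2) rD k] by blast
  qed
  then have "graph_dist (graph_of_parents V E) r v = k"
    using assms(3) by (simp add: graph_dist_eq_LEAST graph_of_parents_def)
  then show ?thesis using k depth_unique[OF E(2) rD k] by metis
qed

lemma pcas_nth: "pcas u p v \<Longrightarrow> Suc k < length p \<Longrightarrow> snd (p ! k) = fst (p ! Suc k)"
proof (induction p arbitrary: u k)
  case (Cons e p)
  show ?case
  proof (cases k)
    case 0
    then show ?thesis using Cons.prems by (cases p) auto
  next
    case (Suc i)
    then show ?thesis using Cons.prems Cons.IH[of "snd e" i] by simp
  qed
qed simp

lemma pcas_last: "pcas u p v \<Longrightarrow> p \<noteq> [] \<Longrightarrow> snd (last p) = v"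
  by (induction p arbitrary: u) auto

lemma pawalk_verts_eq: "pawalk_verts u p = (if p = [] then [u] else map fst p @ [snd (last p)])"
  by (induction p arbitrary: u) auto

text \<open>The cycle is unrolled to a periodic sequence over all naturals, so that the next vertex
  is always given by \<open>Suc\<close> and no wrap-around case arises later.\<close>

lemma cycle_vertex_sequence:
  assumes "pre_digraph.cycle (with_proj G) p"
  obtains x where "\<And>i. (x i, x (Suc i)) \<in> parcs G"
    and "\<And>i j. x i = x j \<Longrightarrow> i mod length p = j mod length p"
    and "\<And>i. x (i + length p) = x i"
proof
  let ?n = "length p" and ?x = "\<lambda>i. fst (p ! (i mod length p))"
  obtain u where u: "set p \<subseteq> parcs G" "pcas u p u" "distinct (tl (pawalk_verts u p))" "p \<noteq> []"
    using assms unfolding pre_digraph.cycle_def pre_digraph.awalk_def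
    by (auto simp: cas_with_proj_eq awalk_verts_with_proj_eq)
  have hd: "fst (p ! 0) = u" using u(2,4) by (cases p) auto
  have n: "?n > 0" using u(4) by simp
  have last: "snd (p ! (?n - 1)) = u" using pcas_last[OF u(2,4)] u(4) by (simp add: last_conv_nth)
  have dist: "distinct (map fst p)"
  proof -
    obtain e q where eq: "p = e # q" "fst e = u" using hd u(4) by (cases p) auto
    have "distinct (map fst q @ [u])"
      using u(3) pcas_last[OF u(2,4)] by (simp add: pawalk_verts_eq eq)
    then show ?thesis by (simp add: eq)
  qed
  show "(?x i, ?x (Suc i)) \<in> parcs G" for i
  proof -
    have "p ! (i mod ?n) \<in> parcs G" using u(1) n by (metis mod_less_divisor nth_mem subsetD)
    moreover have "snd (p ! (i mod ?n)) = ?x (Suc i)"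
    proof (cases "Suc (i mod ?n) = ?n")
      case True
      then have "Suc i mod ?n = 0" by (simp add: mod_Suc)
      moreover have "i mod ?n = ?n - 1" using True by simp
      ultimately show ?thesis using last hd by simp
    next
      case False
      then have "Suc (i mod ?n) < ?n" using n by (metis Suc_lessI mod_less_divisor)
      then show ?thesis using pcas_nth[OF u(2)] False by (simp add: mod_Suc)
    qed
    ultimately show ?thesis by (metis prod.collapse)
  qed
  show "i mod ?n = j mod ?n" if "?x i = ?x j" for i j
    using that n nth_eq_iff_index_eq[OF dist, of "i mod ?n" "j mod ?n"] by simp
  show "?x (i + ?n) = ?x i" for i by simp
qed

text \<open>
  On a cycle, both neighbours of a deepest vertex are its parent, so they coincide and the cycle only
  goes back and forth along one edge.
\<close>

lemma acyclic_graph_graph_of_parents: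
  assumes "finite V" "E \<in> parent_trees V d" "r \<in> V" "Domain E = V - {r}"
  shows "acyclic_graph (graph_of_parents V E)"
  unfolding acyclic_graph_def
proof (rule notI, elim exE conjE)
  fix p assume cyc: "pre_digraph.cycle (with_proj (graph_of_parents V E)) p" and len: "length p \<ge> 3"
  let ?D = "graph_dist (graph_of_parents V E) r"
  have E: "E \<subseteq> V \<times> V" "single_valued E" using assms(2) by (auto simp: parent_trees_def)
  have D: "?D u = Suc (?D v)" if "(u, v) \<in> E" for u v
  proof -
    have "u \<in> V" "v \<in> V" using that E(1) by auto
    then have "(v, r) \<in> E ^^ ?D v" using graph_dist_graph_of_parents[OF assms, of v "?D v"] by simp
    with that have "(u, r) \<in> E ^^ Suc (?D v)" by (rule relpow_Suc_I2)
    then show ?thesis using graph_dist_graph_of_parents[OF assms \<open>u \<in> V\<close>] by blast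
  qed
  obtain x where x: "\<And>i. (x i, x (Suc i)) \<in> E \<union> E\<inverse>"
    and inj: "\<And>i j. x i = x j \<Longrightarrow> i mod length p = j mod length p"
    and per: "\<And>i. x (i + length p) = x i"
    using cycle_vertex_sequence[OF cyc] by (auto simp: graph_of_parents_def)
  have xV: "x i \<in> V" for i using x[of i] E(1) by auto
  have fin: "finite (range (\<lambda>i. ?D (x i)))"
    by (rule finite_subset[of _ "?D ` V"]) (use xV assms(1) in auto)
  have "Max (range (\<lambda>i. ?D (x i))) \<in> range (\<lambda>i. ?D (x i))" by (rule Max_in[OF fin]) simp
  then obtain i where i: "Max (range (\<lambda>i. ?D (x i))) = ?D (x i)" by blast
  \<comment> \<open>Shifting by one period gives the deepest vertex a predecessor index
    \<open>k\<close> even if \<open>i = 0\<close>.\<close>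
  obtain k where k: "i + length p = Suc k" using len by (cases "i + length p") auto
  have max: "?D (x j) \<le> ?D (x (Suc k))" for j
    using Max_ge[OF fin, of "?D (x j)"] i per[of i] k by simp
  have "(x (Suc k), x k) \<in> E" using x[of k] D[of "x k" "x (Suc k)"] max[of k] by auto
  moreover have "(x (Suc k), x (Suc (Suc k))) \<in> E"
    using x[of "Suc k"] D[of "x (Suc (Suc k))" "x (Suc k)"] max[of "Suc (Suc k)"] by auto
  ultimately have "x k = x (Suc (Suc k))" using E(2) unfolding single_valued_def by blast
  then have "(k + 2) mod length p = k mod length p" using inj[of k "Suc (Suc k)"] by simp
  then have "length p dvd 2" using mod_eq_dvd_iff_nat[of k "k + 2" "length p"] by simp
  then have "length p \<le> 2" by (rule dvd_imp_le) simp
  then show False using len by simp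
qed

section \<open>The correspondence between parent relations and rooted labelled trees\<close>

definition rooted_graph_of_parents :: "'a set \<Rightarrow> ('a \<times> 'a) set \<Rightarrow> 'a pair_pre_digraph \<times> 'a" where
  "rooted_graph_of_parents V E = (graph_of_parents V E, THE r. r \<in> V - Domain E)"

lemma rooted_graph_of_parents_eq:
  assumes "r \<in> V" "Domain E = V - {r}"
  shows "rooted_graph_of_parents V E = (graph_of_parents V E, r)"
proof -
  have "V - Domain E = {r}" using assms by blast
  then show ?thesis unfolding rooted_graph_of_parents_def by (simp only: singleton_iff the_eq_trivial)
qed

text \<open>Graph and root determine all distances, and the distances orient every edge: an edge
  oriented oppositely in the two relations would give its end \<open>u\<close> the depths
  \<open>h\<close> and \<open>h + 2\<close>.\<close>

lemma inj_on_rooted_graph_of_parents: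
  assumes "finite V" "(\<Sum>i\<in>V. d i) + 1 = card V"
  shows "inj_on (rooted_graph_of_parents V) (parent_trees V d)"
proof (rule inj_onI)
  fix E E' assume E: "E \<in> parent_trees V d" "E' \<in> parent_trees V d"
    and eq: "rooted_graph_of_parents V E = rooted_graph_of_parents V E'"
  obtain r where r: "r \<in> V" "Domain E = V - {r}" using parent_tree_root[OF assms E(1)] by blast
  obtain r' where r': "r' \<in> V" "Domain E' = V - {r'}" using parent_tree_root[OF assms E(2)] by blast
  have eqs: "r' = r" "graph_of_parents V E = graph_of_parents V E'"
    using eq unfolding rooted_graph_of_parents_eq[OF r] rooted_graph_of_parents_eq[OF r'] by simp_all
  then have arcs: "E \<union> E\<inverse> = E' \<union> E'\<inverse>" by (simp add: graph_of_parents_def)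
  have D': "Domain E' = V - {r}" using r'(2) eqs(1) by simp
  have same: "(v, r) \<in> E ^^ h \<longleftrightarrow> (v, r) \<in> E' ^^ h" if "v \<in> V" for v h
    using graph_dist_graph_of_parents[OF assms(1) E(1) r that, of h]
      graph_dist_graph_of_parents[OF assms(1) E(2) r(1) D' that, of h] eqs(2) by simp
  have sub: "F \<subseteq> F'" if F: "F \<in> parent_trees V d" "Domain F = V - {r}" and sv: "single_valued F'" "Domain F' = V - {r}"
    and arcs: "F \<union> F\<inverse> = F' \<union> F'\<inverse>" and same: "\<And>v h. v \<in> V \<Longrightarrow> (v, r) \<in> F ^^ h \<longleftrightarrow> (v, r) \<in> F' ^^ h" for F F'
  proof (rule subrelI)
    fix v u assume vu: "(v, u) \<in> F"
    show "(v, u) \<in> F'"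
    proof (rule ccontr)
      assume "(v, u) \<notin> F'"
      then have uv: "(u, v) \<in> F'" using vu arcs by blast
      have V: "u \<in> V" "v \<in> V" using vu F(1) by (auto simp: parent_trees_def)
      obtain h where h: "(u, r) \<in> F ^^ h"
        using parent_tree_reaches_root[OF assms(1) F V(1)] by (metis rtrancl_power)
      have "(v, r) \<in> F ^^ Suc h" using vu h by (rule relpow_Suc_I2)
      then have "(v, r) \<in> F' ^^ Suc h" using same[OF V(2)] by blast
      with uv have "(u, r) \<in> F' ^^ Suc (Suc h)" by (rule relpow_Suc_I2)
      moreover have "(u, r) \<in> F' ^^ h" using h same[OF V(1)] by blast
      moreover have "r \<notin> Domain F'" using sv(2) by simp
      ultimately have "Suc (Suc h) = h" using depth_unique[OF sv(1)] by blast
      then show False by simp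
    qed
  qed
  have sv: "single_valued E" "single_valued E'" using E by (simp_all add: parent_trees_def)
  show "E = E'"
  proof
    show "E \<subseteq> E'" by (rule sub[OF E(1) r(2) sv(2) D' arcs same])
    show "E' \<subseteq> E" by (rule sub[OF E(2) D' sv(1) r(2) arcs[symmetric] same[symmetric]])
  qed
qed

lemma card_neighbours:
  assumes "finite V" "E \<subseteq> V \<times> V" "acyclic E"
  shows "card ((E \<union> E\<inverse>) `` {v}) = card (E `` {v}) + card (E\<inverse> `` {v})"
proof -
  have "E `` {v} \<inter> E\<inverse> `` {v} = {}"
  proof (rule equals0I)
    fix u assume "u \<in> E `` {v} \<inter> E\<inverse> `` {v}"
    then have "(v, u) \<in> E" "(u, v) \<in> E" by auto
    then have "(v, v) \<in> E\<^sup>+" by (meson r_into_trancl' trancl_trans)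
    then show False using assms(3) by (simp add: acyclic_def)
  qed
  moreover have "finite (E `` {v})" "finite (E\<inverse> `` {v})"
    using assms(1,2) by (auto intro: finite_subset[of _ V])
  moreover have "(E \<union> E\<inverse>) `` {v} = E `` {v} \<union> E\<inverse> `` {v}" by auto
  ultimately show ?thesis by (simp add: card_Un_disjoint)
qed

lemma card_parents:
  assumes "single_valued E"
  shows "card (E `` {v}) = (if v \<in> Domain E then 1 else 0)"
proof (cases "v \<in> Domain E")
  case True
  then obtain u where "(v, u) \<in> E" by auto
  then have "E `` {v} = {u}" using assms by (auto simp: single_valued_def)
  then show ?thesis using True by simp
next
  case False
  then have "E `` {v} = {}" by auto
  then show ?thesis using False by simp
qed

lemma rooted_graph_of_parents_in_trees:
  assumes "(\<Sum>i = 1..n. d i) + 1 = n" "E \<in> parent_trees {1..n} d"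
  shows "rooted_graph_of_parents {1..n} E \<in> rooted_labelled_trees n d"
proof -
  let ?V = "{1..n}" and ?G = "graph_of_parents {1..n} E"
  have sum: "(\<Sum>i\<in>?V. d i) + 1 = card ?V" using assms(1) by simp
  have E: "E \<subseteq> ?V \<times> ?V" "single_valued E" "acyclic E" "\<And>i. i \<in> ?V \<Longrightarrow> card (E\<inverse> `` {i}) = d i"
    using assms(2) unfolding parent_trees_def by blast+
  obtain r where r: "r \<in> ?V" "Domain E = ?V - {r}" using parent_tree_root[OF _ sum assms(2)] by blast
  have deg: "out_degree (with_proj ?G) i = (if i = r then d i else d i + 1)" if "i \<in> ?V" for i
  proof -
    have "out_degree (with_proj ?G) i = card ((E \<union> E\<inverse>) `` {i})"
      unfolding out_degree_with_proj by (simp add: graph_of_parents_def)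
    also have "\<dots> = card (E `` {i}) + card (E\<inverse> `` {i})" by (rule card_neighbours[OF _ E(1,3)]) simp
    finally show ?thesis using card_parents[OF E(2), of i] r(2) E(4)[OF that] that by simp
  qed
  have "Digraph_Component.connected (with_proj ?G)"
  proof (subst connected_with_proj_iff)
    show "sym (parcs ?G)" by (auto simp: graph_of_parents_def sym_def)
    show "parcs ?G \<subseteq> pverts ?G \<times> pverts ?G" using E(1) by (auto simp: graph_of_parents_def)
    have "(u, v) \<in> (E \<union> E\<inverse>)\<^sup>*" if "u \<in> ?V" "v \<in> ?V" for u v
    proof -
      have "(u, r) \<in> E\<^sup>*" "(v, r) \<in> E\<^sup>*"
        using parent_tree_reaches_root[OF _ assms(2) r(2)] that by simp_all
      then have "(u, r) \<in> (E \<union> E\<inverse>)\<^sup>*" "(r, v) \<in> (E \<union> E\<inverse>)\<^sup>*"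
        using rtrancl_mono[of E "E \<union> E\<inverse>"] rtrancl_mono[of "E\<inverse>" "E \<union> E\<inverse>"] by (blast dest: rtrancl_converseI)+
      then show ?thesis by (rule rtrancl_trans)
    qed
    then show "pverts ?G \<noteq> {} \<and> (\<forall>u\<in>pverts ?G. \<forall>v\<in>pverts ?G. (u, v) \<in> (parcs ?G)\<^sup>*)"
      using r(1) by (auto simp: graph_of_parents_def)
  qed
  moreover have "pair_graph ?G" by (rule pair_graph_graph_of_parents[OF _ E(1,3)]) simp
  moreover have "acyclic_graph ?G" by (rule acyclic_graph_graph_of_parents[OF _ assms(2) r]) simp
  moreover have "pverts ?G = ?V" by (simp add: graph_of_parents_def)
  ultimately show ?thesis
    unfolding rooted_graph_of_parents_eq[OF r] rooted_labelled_trees_def using r(1) deg by simp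
qed

text \<open>
  Conversely, in a rooted labelled tree let every vertex other than the root choose the neighbours
  that are closer to the root. There are at least \<open>n - 1\<close> such arcs, and the graph has
  \<open>2 (n - 1)\<close> arcs altogether, so there are no other edges and the choice is unique.
\<close>

lemma rooted_labelled_tree_is_graph_of_parents:
  assumes "(\<Sum>i = 1..n. d i) + 1 = n" "(G, r) \<in> rooted_labelled_trees n d"
  shows "\<exists>E\<in>parent_trees {1..n} d. rooted_graph_of_parents {1..n} E = (G, r)"
proof -
  let ?V = "{1..n}" and ?A = "parcs G" and ?D = "graph_dist G r"
  define E where "E = {(v, u) \<in> ?A. ?D v = Suc (?D u)}"
  have pg: "pair_graph G" and V: "pverts G = ?V" and conn: "Digraph_Component.connected (with_proj G)"
    and r: "r \<in> ?V" and degr: "out_degree (with_proj G) r = d r"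
    and deg: "\<And>i. i \<in> ?V - {r} \<Longrightarrow> out_degree (with_proj G) i = d i + 1"
    using assms(2) by (auto simp: rooted_labelled_trees_def)
  interpret pair_graph G by (rule pg)
  have sym: "sym ?A" using pair_sym_arcs by (simp add: Digraph.symmetric_def)
  have AV: "?A \<subseteq> ?V \<times> ?V" using in_arcsD1 in_arcsD2 V by auto
  have finA: "finite ?A" by (rule pair_finite_arcs)
  have reach: "(r, v) \<in> ?A ^^ ?D v" if "v \<in> ?V" for v
  proof -
    have "(r, v) \<in> ?A\<^sup>*" using conn r that AV V by (simp add: connected_with_proj_iff[OF sym])
    then obtain k where "(r, v) \<in> ?A ^^ k" by (metis rtrancl_power)
    then show ?thesis using LeastI[of "\<lambda>k. (r, v) \<in> ?A ^^ k"] r V by (simp add: graph_dist_eq_LEAST)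
  qed
  have least: "?D v \<le> k" if "(r, v) \<in> ?A ^^ k" for v k
    using Least_le[of "\<lambda>k. (r, v) \<in> ?A ^^ k", OF that] r V by (simp add: graph_dist_eq_LEAST)
  have Dr: "?D r = 0" using least[of r 0] by simp
  have EV: "E \<subseteq> ?V \<times> ?V" using AV by (auto simp: E_def)
  have dom: "Domain E = ?V - {r}"
  proof
    show "Domain E \<subseteq> ?V - {r}" using EV Dr by (auto simp: E_def)
    show "?V - {r} \<subseteq> Domain E"
    proof
      fix v assume v: "v \<in> ?V - {r}"
      have "?D v \<noteq> 0"
      proof
        assume "?D v = 0"
        then show False using reach[of v] v by simp
      qed
      then obtain k where k: "?D v = Suc k" using not0_implies_Suc by blast
      have "(r, v) \<in> ?A ^^ Suc k" using reach[of v] v k by simp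
      then obtain u where u: "(r, u) \<in> ?A ^^ k" "(u, v) \<in> ?A" by auto
      have "u \<in> ?V" using u(2) AV by auto
      then have "(r, v) \<in> ?A ^^ Suc (?D u)" using reach u(2) by auto
      \<comment> \<open>The walk shows that \<open>u\<close> is at distance at most
        \<open>k\<close>; a smaller distance would bring \<open>v\<close> closer than
        \<open>Suc k\<close>.\<close>
      then have "?D u = k" using least[OF u(1)] least[of v "Suc (?D u)"] k by simp
      moreover have "(v, u) \<in> ?A" using u(2) sym by (simp add: sym_def)
      ultimately show "v \<in> Domain E" using k by (auto simp: E_def)
    qed
  qed
  have finE: "finite E" using finA by (rule rev_finite_subset) (auto simp: E_def)
  have cdom: "card (Domain E) = n - 1" unfolding dom using r by simp
  have cge: "n - 1 \<le> card E"
    using card_image_le[OF finE, of fst] cdom by (simp add: Domain_fst)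
  have cA: "card ?A = 2 * (n - 1)"
  proof -
    have A: "?A = Sigma ?V (\<lambda>v. ?A `` {v})" using AV by auto
    have "card (Sigma ?V (\<lambda>v. ?A `` {v})) = (\<Sum>v\<in>?V. card (?A `` {v}))"
      using AV by (intro card_SigmaI) (auto intro: finite_subset[of _ ?V])
    with A have "card ?A = (\<Sum>v\<in>?V. out_degree (with_proj G) v)" by (simp add: out_degree_with_proj)
    also have "\<dots> = out_degree (with_proj G) r + (\<Sum>v\<in>?V - {r}. out_degree (with_proj G) v)"
      by (rule sum.remove) (use r in auto)
    also have "\<dots> = d r + (\<Sum>v\<in>?V - {r}. d v + 1)"
      unfolding degr using deg by (intro arg_cong2[where f = "(+)"] sum.cong) auto
    also have "\<dots> = (d r + (\<Sum>v\<in>?V - {r}. d v)) + card (?V - {r})"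
      by (simp only: sum.distrib sum_constant) simp
    also have "d r + (\<Sum>v\<in>?V - {r}. d v) = (\<Sum>v\<in>?V. d v)"
      by (rule sum.remove[symmetric]) (use r in auto)
    also have "card (?V - {r}) = n - 1" using r by simp
    finally show ?thesis using assms(1) by simp
  qed
  have disj: "E \<inter> E\<inverse> = {}" by (auto simp: E_def)
  have sub: "E \<union> E\<inverse> \<subseteq> ?A" using sym by (auto simp: E_def sym_def)
  have cU: "card (E \<union> E\<inverse>) = 2 * card E"
    using finE disj by (simp add: card_Un_disjoint)
  have arcs: "E \<union> E\<inverse> = ?A"
    using card_mono[OF finA sub] cU cge cA by (intro card_subset_eq[OF finA sub]) linarith
  have cE: "card E = n - 1" using cU arcs cA by simp
  have sv: "single_valued E"
  proof -
    have "card (fst ` E) = card E" using cE cdom by (simp add: Domain_fst)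
    then have inj: "inj_on fst E" using finE by (intro eq_card_imp_inj_on)
    show ?thesis
    proof (rule single_valuedI)
      fix x y z assume "(x, y) \<in> E" "(x, z) \<in> E"
      then show "y = z" using inj_onD[OF inj, of "(x, y)" "(x, z)"] by simp
    qed
  qed
  have ac: "acyclic E" by (rule acyclicI_order[where f = "?D"]) (auto simp: E_def)
  have "card (E\<inverse> `` {i}) = d i" if i: "i \<in> ?V" for i
  proof -
    have "out_degree (with_proj G) i = card (E `` {i}) + card (E\<inverse> `` {i})"
      unfolding out_degree_with_proj arcs[symmetric] by (rule card_neighbours[OF _ EV ac]) simp
    then show ?thesis using card_parents[OF sv, of i] dom degr deg[of i] i by (cases "i = r") simp_all
  qed
  then have "E \<in> parent_trees ?V d" using EV sv ac by (simp add: parent_trees_def)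
  moreover have "graph_of_parents ?V E = G" using V arcs by (cases G) (simp add: graph_of_parents_def)
  ultimately show ?thesis using rooted_graph_of_parents_eq[OF r dom] by (intro bexI[of _ E]) simp_all
qed

lemma rooted_labelled_trees_eq_image:
  assumes "(\<Sum>i = 1..n. d i) + 1 = n"
  shows "rooted_labelled_trees n d = rooted_graph_of_parents {1..n} ` parent_trees {1..n} d"
proof
  show "rooted_labelled_trees n d \<subseteq> rooted_graph_of_parents {1..n} ` parent_trees {1..n} d"
  proof
    fix t assume t: "t \<in> rooted_labelled_trees n d"
    obtain G r where "t = (G, r)" by (cases t)
    then show "t \<in> rooted_graph_of_parents {1..n} ` parent_trees {1..n} d"
      using rooted_labelled_tree_is_graph_of_parents[OF assms] t by (metis imageI)
  qed
qed (use rooted_graph_of_parents_in_trees[OF assms] in blast)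

section \<open>Combining the two bounds\<close>

lemma parent_tree_of_width_height:
  fixes E :: "(nat \<times> nat) set"
  assumes "finite V" "E \<in> parent_trees V d" "r \<in> V" "Domain E = V - {r}"
  shows "\<exists>h. tree_width (graph_of_parents V E, r) = card ((E ^^ h)\<inverse> `` {r})"
    and "\<exists>v\<in>V. v \<in> Domain (E ^^ tree_height (graph_of_parents V E, r))"
proof -
  let ?D = "graph_dist (graph_of_parents V E) r"
  have E: "E \<subseteq> V \<times> V" using assms(2) by (simp add: parent_trees_def)
  have V: "pverts (graph_of_parents V E) = V" by (simp add: graph_of_parents_def)
  let ?c = "\<lambda>h. card {v \<in> V. ?D v = h}"
  have level: "{v \<in> V. ?D v = h} = (E ^^ h)\<inverse> `` {r}" for h
  proof -
    have "v \<in> V" if "(v, r) \<in> E ^^ h" for v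
    proof (cases h)
      case 0
      then show ?thesis using that assms(3) by simp
    next
      case (Suc i)
      then obtain y where "(v, y) \<in> E" using \<open>(v, r) \<in> E ^^ h\<close> by (metis relpow_Suc_D2)
      then show ?thesis using E by blast
    qed
    then show ?thesis using graph_dist_graph_of_parents[OF assms, of _ h] by blast
  qed
  have "finite (range ?c)"
    by (rule finite_subset[of _ "{..card V}"]) (use assms(1) in \<open>auto intro: card_mono\<close>)
  then have "Max (range ?c) \<in> range ?c" by (rule Max_in) simp
  then obtain h where "Max (range ?c) = ?c h" by blast
  then show "\<exists>h. tree_width (graph_of_parents V E, r) = card ((E ^^ h)\<inverse> `` {r})"
    by (intro exI[of _ h]) (simp only: tree_width.simps V level)
  have "Max (?D ` V) \<in> ?D ` V" by (rule Max_in) (use assms(1,3) in auto)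
  then obtain v where v: "v \<in> V" "Max (?D ` V) = ?D v" by blast
  then have "(v, r) \<in> E ^^ ?D v" using graph_dist_graph_of_parents[OF assms v(1), of "?D v"] by simp
  then show "\<exists>v\<in>V. v \<in> Domain (E ^^ tree_height (graph_of_parents V E, r))"
    using v by (intro bexI[of _ v]) (auto simp only: tree_height.simps V intro: DomainI)
qed

text \<open>In terms of \<open>y = x * sqrt (1 + U)\<close> the numerator is
  \<open>y\<^sup>2 - x\<^sup>2 \<ge> y\<^sup>2 - 1 / 4\<close> and the denominator at most
  \<open>4 * (3 / 2 + y)\<close>. The quotient thus grows linearly and is at least
  \<open>y / 12\<close> once \<open>y \<ge> 2\<close>, which \<open>z \<ge> 4\<close>
  ensures.\<close>

lemma height_exponent_ge:
  fixes U x z :: real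
  assumes "U \<ge> 0" "0 \<le> x" "x \<le> 1 / 2" "z \<ge> 4" "z / 2 \<le> x * sqrt (1 + U)"
  shows "z / 24 \<le> U * x\<^sup>2 / (4 * (1 + x + sqrt U * x))"
proof -
  define y where "y = x * sqrt (1 + U)"
  have y1: "y \<ge> 2" "z / 2 \<le> y" using assms(4,5) by (simp_all add: y_def)
  have "y\<^sup>2 = x\<^sup>2 * (1 + U)" using assms(1) by (simp add: y_def power_mult_distrib)
  then have Ux: "U * x\<^sup>2 = y\<^sup>2 - x\<^sup>2" by (simp add: algebra_simps)
  have "x\<^sup>2 \<le> (1 / 2)\<^sup>2" using assms(2,3) by (intro power_mono)
  then have num: "y\<^sup>2 - 1 / 4 \<le> U * x\<^sup>2" unfolding Ux by (simp add: power2_eq_square)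
  have "sqrt U * x \<le> y" unfolding y_def using assms(1,2) by (simp add: mult.commute mult_left_mono)
  then have den: "4 * (1 + x + sqrt U * x) \<le> 4 * (3 / 2 + y)" using assms(3) by simp
  have pos: "4 * (1 + x + sqrt U * x) > 0" using assms(1,2) by (intro mult_pos_pos add_pos_nonneg) auto
  have "2 * y \<le> y * y" using y1(1) by (intro mult_right_mono) auto
  moreover have "y / 12 * (4 * (3 / 2 + y)) = y / 2 + y * y / 3" by (simp add: algebra_simps)
  ultimately have "y / 12 * (4 * (3 / 2 + y)) \<le> y\<^sup>2 - 1 / 4"
    using y1(1) unfolding power2_eq_square by linarith
  moreover have "y / 12 * (4 * (1 + x + sqrt U * x)) \<le> y / 12 * (4 * (3 / 2 + y))"
    using den y1(1) by (intro mult_left_mono) auto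
  ultimately have "y / 12 * (4 * (1 + x + sqrt U * x)) \<le> U * x\<^sup>2" using num by linarith
  then have "y / 12 \<le> U * x\<^sup>2 / (4 * (1 + x + sqrt U * x))" using pos by (simp add: pos_le_divide_eq)
  then show ?thesis using y1(2) by linarith
qed

text \<open>The left side is \<open>x powr (1 - q)\<close>, and \<open>x \<ge> exp 1\<close> reduces
  it to \<open>exp (1 - q)\<close>. Taken at \<open>x = n\<close>, this absorbs the factor
  \<open>n\<close> of the union bound into the exponent and leaves a bound uniform in
  \<open>n\<close>.\<close>

lemma mult_exp_neg_ln_le:
  fixes q x :: real
  assumes "q \<ge> 1" "ln x \<ge> 1" "x > 0"
  shows "x * exp (- (q * ln x)) \<le> 1 / q"
proof -
  have "x * exp (- (q * ln x)) = exp (ln x - q * ln x)" using assms(3) by (simp add: exp_diff exp_minus divide_inverse)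
  also have "\<dots> \<le> exp (- (q - 1))"
  proof -
    have "(q - 1) * 1 \<le> (q - 1) * ln x" using assms by (intro mult_left_mono) auto
    then show ?thesis by (simp add: algebra_simps)
  qed
  also have "\<dots> = 1 / exp (q - 1)" by (simp only: exp_minus inverse_eq_divide)
  also have "\<dots> \<le> 1 / q" using exp_ge_add_one_self[of "q - 1"] assms(1) by (intro divide_left_mono) auto
  finally show ?thesis .
qed

lemma card_wide_and_high_le:
  fixes n :: nat and d :: "nat \<Rightarrow> nat" and s :: real
  assumes n: "n \<ge> 3" and sum: "(\<Sum>i = 1..n. d i) + 1 = n" and s: "s \<ge> 2304"
  shows "real (card {t \<in> rooted_labelled_trees n d. real (tree_width t) * real (tree_height t) > s * real n * ln (real n)})
    \<le> 53 / sqrt s * real (card (rooted_labelled_trees n d))"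
proof -
  let ?V = "{1..n}"
  let ?T = "parent_trees ?V d" and ?\<Phi> = "rooted_graph_of_parents ?V"
  let ?bad = "\<lambda>t. real (tree_width t) * real (tree_height t) > s * real n * ln (real n)"
  define U where "U = (\<Sum>i\<in>?V. real (d i * (d i - 1)))"
  define w where "w = sqrt s * sqrt (1 + U)"
  \<comment> \<open>The height threshold complementary to \<open>w\<close>: their product is
    \<open>s * n * ln n\<close>, each taking one factor \<open>sqrt s\<close>, so a larger product
    forces width at least \<open>w\<close> or height at least \<open>t\<close>.\<close>
  define t where "t = sqrt s * real n * ln (real n) / sqrt (1 + U)"
  define k where "k = nat \<lceil>t\<rceil>"
  let ?W = "{E \<in> ?T. \<exists>r\<in>?V - Domain E. \<exists>h. w \<le> real (card ((E ^^ h)\<inverse> `` {r}))}"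
  let ?H = "{E \<in> ?T. \<exists>v\<in>?V. v \<in> Domain (E ^^ k)}"
  have sumV: "(\<Sum>i\<in>?V. d i) + 1 = card ?V" using sum by simp
  have U0: "U \<ge> 0" unfolding U_def by (rule sum_nonneg) simp
  have s48: "sqrt s \<ge> 48" using s real_sqrt_le_mono[of "48\<^sup>2" s] by simp
  have sU1: "sqrt (1 + U) \<ge> 1" using U0 by simp
  have ln1: "ln (real n) \<ge> 1"
  proof -
    have "exp 1 \<le> real n" using exp_le n by linarith
    then show ?thesis using n by (simp add: ln_ge_iff)
  qed
  have w1: "w > 1"
  proof -
    have "48 * 1 \<le> w" unfolding w_def using s s48 sU1 by (intro mult_mono) auto
    then show ?thesis by simp
  qed
  have t0: "t > 0" unfolding t_def using s sU1 ln1 n by (intro divide_pos_pos mult_pos_pos) auto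
  have k1: "k \<ge> 1" using t0 by (simp add: k_def Suc_le_eq)
  have tk: "t \<le> real k" unfolding k_def by (rule real_nat_ceiling_ge)
  have wt: "w * t = s * real n * ln (real n)"
    unfolding w_def t_def using s sU1 by simp
  have finT: "finite ?T" by (rule finite_parent_trees) simp
  have sub: "{t \<in> rooted_labelled_trees n d. ?bad t} \<subseteq> ?\<Phi> ` (?W \<union> ?H)"
  proof
    fix tr assume "tr \<in> {t \<in> rooted_labelled_trees n d. ?bad t}"
    then obtain E where E: "E \<in> ?T" "tr = ?\<Phi> E" "?bad (?\<Phi> E)"
      unfolding rooted_labelled_trees_eq_image[OF sum] by blast
    obtain r where r: "r \<in> ?V" "Domain E = ?V - {r}" using parent_tree_root[OF _ sumV E(1)] by blast
    let ?t = "(graph_of_parents ?V E, r)"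
    have bad: "w * t < real (tree_width ?t) * real (tree_height ?t)"
      using E(3) unfolding rooted_graph_of_parents_eq[OF r] wt .
    note wh = parent_tree_of_width_height[OF _ E(1) r]
    have "w \<le> real (tree_width ?t) \<or> t \<le> real (tree_height ?t)"
    proof (rule ccontr)
      assume "\<not> ?thesis"
      then have "real (tree_width ?t) * real (tree_height ?t) \<le> w * t"
        using w1 by (intro mult_mono) auto
      then show False using bad by linarith
    qed
    then have "E \<in> ?W \<union> ?H"
    proof
      assume "w \<le> real (tree_width ?t)"
      moreover obtain h where "tree_width ?t = card ((E ^^ h)\<inverse> `` {r})" using wh(1) by blast
      ultimately have "w \<le> real (card ((E ^^ h)\<inverse> `` {r}))" by metis
      moreover have "r \<in> ?V - Domain E" using r by blast
      ultimately show ?thesis using E(1) by blast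
    next
      assume "t \<le> real (tree_height ?t)"
      then have "k \<le> tree_height ?t" unfolding k_def by (simp only: nat_le_iff ceiling_le_iff of_int_of_nat_eq)
      moreover obtain v where "v \<in> ?V" "v \<in> Domain (E ^^ tree_height ?t)" using wh(2) by blast
      ultimately have "v \<in> Domain (E ^^ k)" using Domain_relpow_antimono by metis
      then show ?thesis using E(1) \<open>v \<in> ?V\<close> by blast
    qed
    then show "tr \<in> ?\<Phi> ` (?W \<union> ?H)" using E(2) by blast
  qed
  have finWH: "finite ?W" "finite ?H" using finT by simp_all
  have "card {t \<in> rooted_labelled_trees n d. ?bad t} \<le> card (?\<Phi> ` (?W \<union> ?H))"
    by (rule card_mono[OF _ sub]) (use finWH in blast)
  also have "\<dots> \<le> card (?W \<union> ?H)" by (rule card_image_le) (use finWH in blast)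
  also have "\<dots> \<le> card ?W + card ?H" by (rule card_Un_le)
  finally have "real (card {t \<in> rooted_labelled_trees n d. ?bad t}) \<le> real (card ?W) + real (card ?H)"
    by linarith
  also have "real (card ?W) \<le> 5 / sqrt s * real (card ?T)"
  proof -
    have "real (card ?W) \<le> (1 + 5 * U) / w\<^sup>2 * real (card ?T)"
      unfolding U_def by (rule card_wide_parent_trees_le[OF _ sumV w1]) simp
    \<comment> \<open>The estimate obtained is \<open>5 / s\<close>; it is weakened to
      \<open>5 / sqrt s\<close> so that it can be added to the height term.\<close>
    also have "(1 + 5 * U) / w\<^sup>2 \<le> 5 / sqrt s"
    proof -
      have "(1 + 5 * U) / w\<^sup>2 = (1 + 5 * U) / (1 + U) / s"
        unfolding w_def using s U0 by (simp add: power_mult_distrib)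
      also have "\<dots> \<le> 5 / s" using s U0 by (intro divide_right_mono) (simp_all add: pos_divide_le_eq)
      also have "\<dots> \<le> 5 / sqrt s"
      proof (rule divide_left_mono)
        have "sqrt s * 1 \<le> sqrt s * sqrt s" using s s48 by (intro mult_left_mono) auto
        then show "sqrt s \<le> s" using s by simp
      qed (use s in auto)
      finally show ?thesis .
    qed
    finally show ?thesis by (simp add: mult_right_mono)
  qed
  also have "real (card ?H) \<le> 48 / sqrt s * real (card ?T)"
  proof (cases "k \<le> n - 1")
    case True
    define x where "x = real k / (2 * real (card ?V - 1))"
    have x0: "0 \<le> x" by (simp add: x_def)
    have x1: "x \<le> 1 / 2" using True n by (simp add: x_def divide_simps)
    define z where "z = sqrt s * ln (real n)"
    have z2: "z \<ge> 4"
    proof -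
      have "48 * 1 \<le> z" unfolding z_def using s s48 ln1 by (intro mult_mono) auto
      then show ?thesis by simp
    qed
    have "z / 2 \<le> x * sqrt (1 + U)"
    proof -
      have "t / (2 * real n) \<le> real k / (2 * real (card ?V - 1))"
        using t0 tk n by (intro frac_le) auto
      then have "t / (2 * real n) * sqrt (1 + U) \<le> x * sqrt (1 + U)"
        unfolding x_def using sU1 by (intro mult_right_mono) auto
      moreover have "t / (2 * real n) * sqrt (1 + U) = z / 2"
        unfolding t_def z_def using sU1 n by simp
      ultimately show ?thesis by (simp only:)
    qed
    then have ex: "z / 24 \<le> U * x\<^sup>2 / (4 * (1 + x + sqrt U * x))"
      by (rule height_exponent_ge[OF U0 x0 x1 z2])
    have "real (card ?H) \<le> 2 * real (card ?V) * exp (- (U * x\<^sup>2 / (4 * (1 + x + sqrt U * x)))) * real (card ?T)"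
      by (rule card_parent_trees_height_ge[OF _ sumV k1 x_def U_def]) simp
    also have "\<dots> \<le> 48 / sqrt s * real (card ?T)"
    proof (rule mult_right_mono)
      have "real n * exp (- (U * x\<^sup>2 / (4 * (1 + x + sqrt U * x)))) \<le> real n * exp (- (sqrt s / 24 * ln (real n)))"
        using ex by (intro mult_left_mono) (simp_all add: z_def)
      \<comment> \<open>Here \<open>q = sqrt s / 24\<close>; the factor 2 of the depth bound turns
        \<open>24 / sqrt s\<close> into \<open>48 / sqrt s\<close>.\<close>
      also have "\<dots> \<le> 1 / (sqrt s / 24)"
        using s48 ln1 n by (intro mult_exp_neg_ln_le) auto
      finally show "2 * real (card ?V) * exp (- (U * x\<^sup>2 / (4 * (1 + x + sqrt U * x)))) \<le> 48 / sqrt s"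
        by simp
    qed simp
    finally show ?thesis .
  next
    case False
    have "\<not> (\<exists>v\<in>?V. v \<in> Domain (E ^^ k))" if "E \<in> ?T" for E
      using relpow_parent_tree_less_card[OF _ that, of _ _ k] False by fastforce
    then have "?H = {}" by blast
    then have "card ?H = 0" by (simp only: card.empty)
    then show ?thesis using s by simp
  qed
  finally have "real (card {t \<in> rooted_labelled_trees n d. ?bad t}) \<le> 53 / sqrt s * real (card ?T)"
    by (simp add: add_divide_distrib[symmetric] distrib_right[symmetric])
  moreover have "card (rooted_labelled_trees n d) = card ?T"
    unfolding rooted_labelled_trees_eq_image[OF sum]
    by (rule card_image[OF inj_on_rooted_graph_of_parents[OF _ sumV]]) simp
  ultimately show ?thesis by simp
qed

text \<open>The threshold is \<open>2304 = 48\<^sup>2\<close>. Above it \<open>53 / sqrt s\<close>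
  is stronger than the claim because \<open>s \<ge> 1\<close>; below it the claimed bound is at
  least 1. Nothing is lost, as \<open>53 / sqrt s\<close> exceeds 1 until
  \<open>s = 53\<^sup>2\<close>.\<close>

theorem theorem1p3:
  fixes n :: nat and d :: "nat \<Rightarrow> nat" and s :: real
  assumes "n \<ge> 3"
    and "(\<Sum>i = 1..n. d i) = n - 1"
    and "s > 0"
  shows "measure_pmf.prob (pmf_of_set (rooted_labelled_trees n d))
           {t. real (tree_width t) * real (tree_height t) > s * real n * ln (real n)}
         \<le> 230 * s powr (- 2 / 13)"
proof (cases "s \<ge> 2304")
  case True
  let ?S = "rooted_labelled_trees n d"
  let ?B = "{t. real (tree_width t) * real (tree_height t) > s * real n * ln (real n)}"
  have sum: "(\<Sum>i = 1..n. d i) + 1 = n" using assms(1,2) by simp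
  \<comment> \<open>Nonemptiness follows from the count: multiplied by the factorials of the degrees
    it equals \<open>fact (n - 1)\<close>, which is positive.\<close>
  have ne: "?S \<noteq> {}"
  proof
    assume "?S = {}"
    then have "parent_trees {1..n} d = {}" unfolding rooted_labelled_trees_eq_image[OF sum] by simp
    then show False using card_parent_trees[of "{1..n}" d] sum by simp
  qed
  have fin: "finite ?S" by (rule finite_rooted_labelled_trees)
  have c0: "real (card ?S) > 0" using ne fin by (simp add: card_gt_0_iff)
  have "measure_pmf.prob (pmf_of_set ?S) ?B = real (card (?S \<inter> ?B)) / real (card ?S)"
    by (rule measure_pmf_of_set[OF ne fin])
  also have "?S \<inter> ?B = {t \<in> ?S. real (tree_width t) * real (tree_height t) > s * real n * ln (real n)}"
    by (simp only: Int_def mem_Collect_eq)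
  also have "real (card \<dots>) / real (card ?S) \<le> 53 / sqrt s"
    unfolding pos_divide_le_eq[OF c0] by (rule card_wide_and_high_le[OF assms(1) sum True])
  also have "\<dots> = 53 * s powr (- (1 / 2))"
    using assms(3) by (simp only: powr_minus_divide powr_half_sqrt less_imp_le times_divide_eq_right mult_1_right)
  also have "\<dots> \<le> 230 * s powr (- 2 / 13)"
  proof (rule mult_mono)
    show "s powr (- (1 / 2)) \<le> s powr (- 2 / 13)" by (rule powr_mono) (use True in simp_all)
  qed simp_all
  finally show ?thesis .
next
  case False
  define b :: real where "b = 48\<^sup>2"
  have b: "s \<le> b" "1 \<le> b" "sqrt b = 48" using False by (simp_all add: b_def)
  have "s powr (2 / 13) \<le> b powr (2 / 13)" by (rule powr_mono2) (use assms(3) b in simp_all)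
  also have "\<dots> \<le> b powr (1 / 2)" by (rule powr_mono) (use b in simp_all)
  also have "\<dots> = 48" using b powr_half_sqrt[of b] by simp
  finally have le: "s powr (2 / 13) \<le> 230" by simp
  have "1 = s powr (2 / 13) * s powr (- 2 / 13)" using assms(3) by (simp flip: powr_add)
  also have "\<dots> \<le> 230 * s powr (- 2 / 13)" using le by (rule mult_right_mono) simp
  finally have "1 \<le> 230 * s powr (- 2 / 13)" .
  then show ?thesis by (rule order_trans[OF measure_pmf.prob_le_1])
qed


end
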